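(* Let $\theta\neq\frac{\pi}{3}$. The configuration space $\mathcal M_6(\theta)$ of $\theta$-equiangular unit equilateral hexagons is homeomorphic to - a point if $\theta=0$ or $\theta=\frac{2\pi}{3}$; - the (disjoint) union of a circle and a pair of points if $\frac{\pi}{3}<\theta<\frac{2\pi}{3}$; - the (disjoint) union of two circles and four points if $0<\theta<\frac{\pi}{3}$; - the empty set if $\theta<0$ or $\theta>\frac{2\pi}{3}$. Moreover, for $0<\theta<\frac{2\pi}{3}$, $\theta\ne\frac\pi3$, the classes of boats lie in the connected components of $\mathcal M_6(\theta)$ that are homeomorphic to circles (the single circle component if $\frac{\pi}{3}<\theta<\frac{2\pi}{3}$, the two circle components if $0<\theta<\frac{\pi}{3}$), and the classes of chairs are isolated points of $\mathcal M_6(\theta)$.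
   Context: Indices of vertices are modulo $6$. For a real number $\theta$, let $$\widetilde{\mathcal M}_6(\theta)=\{(P_0,\dots,P_5)\in(\mathbb R^3)^6 : |P_i-P_{i+1}|=1,\ \angle P_{i-1}P_iP_{i+1}=\theta \text{ for all } i \text{ mod } 6\}$$ with the subspace topology (angles between vectors take values in $[0,\pi]$). Let $G$ be the group of orientation preserving isometries of $\mathbb R^3$, acting diagonally. The configuration space is $\mathcal M_6(\theta)=\widetilde{\mathcal M}_6(\theta)/G$ with the quotient topology. Vertices are labelled (distinguished); intersections of edges and coincidences of vertices are allowed. Boat and chair: a hexagon in $\widetilde{\mathcal M}_6(\theta)$ is called a boat (resp. a chair) if for some $i$ one has $\overrightarrow{P_{i-1}P_{i-2}}=\overrightarrow{P_{i+1}P_{i+2}}$, the four points $P_{i-1},P_{i+1},P_{i+2},P_{i-2}$ being the vertices of a non-degenerate parallelogram, and the points $P_i$ and $P_{i+3}$ lie strictly on the same side (resp. strictly on opposite sides) of the plane containing these four points. These properties depend only on the class in $\mathcal M_6(\theta)$. *)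

theory Defs
  imports "HOL-Analysis.Analysis"
begin

text \<open>
  A hexagon is an element of \<^typ>\<open>real^3^6\<close>, whose topology is the product topology. The index type
  \<^typ>\<open>6\<close> is the ring of integers modulo \<open>6\<close>, so that \<open>i + 1\<close>, \<open>i - 2\<close> etc. are
  automatically reduced modulo \<open>6\<close>.
\<close>

text \<open>The angle \<open>A B C\<close> at the vertex \<open>B\<close>, with values in \<open>[0, \<pi>]\<close> whenever \<open>A \<noteq> B \<noteq> C\<close>.\<close>

definition vertex_angle :: "real^3 \<Rightarrow> real^3 \<Rightarrow> real^3 \<Rightarrow> real" where
  "vertex_angle A B C = arccos (((A - B) \<bullet> (C - B)) / (norm (A - B) * norm (C - B)))"

definition hexagons :: "real \<Rightarrow> (real^3^6) set" where
  "hexagons \<theta> = {P. \<forall>i. dist (P $ i) (P $ (i + 1)) = 1 \<and>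
                        vertex_angle (P $ (i - 1)) (P $ i) (P $ (i + 1)) = \<theta>}"

text \<open>
  A distance preserving map \<open>g\<close> is affine with linear part \<open>\<lambda>x. g x - g 0\<close>; it preserves
  orientation if this linear part has positive determinant. (For maps that are not affine
  \<^const>\<open>matrix\<close> would be meaningless, but these are excluded by the first conjunct;
  cf. \<open>rigid_motions_eq\<close>.)
\<close>

definition rigid_motions :: "(real^3 \<Rightarrow> real^3) set" where
  "rigid_motions = {g. (\<forall>x y. dist (g x) (g y) = dist x y) \<and> det (matrix (\<lambda>x. g x - g 0)) > 0}"

lemma rigid_motions_eq:
  "rigid_motions = {\<lambda>x. A *v x + b | A b. rotation_matrix A}"
proof (intro equalityI subsetI)
  fix g assume g: "g \<in> rigid_motions"
  define h where "h = (\<lambda>x. g x - g 0)"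
  have "orthogonal_transformation h"
    using g unfolding orthogonal_transformation_isometry h_def rigid_motions_def
    by (auto simp: dist_norm)
  then have "linear h" and orth: "orthogonal_matrix (matrix h)"
    by (auto simp: orthogonal_transformation_matrix)
  moreover have "det (matrix h) > 0"
    using g by (simp add: rigid_motions_def h_def)
  ultimately have "rotation_matrix (matrix h)"
    using det_orthogonal_matrix[OF orth] by (auto simp: rotation_matrix_def)
  moreover have "g = (\<lambda>x. matrix h *v x + g 0)"
    using \<open>linear h\<close> by (auto simp: fun_eq_iff matrix_works linear_matrix_vector_mul_eq h_def)
  ultimately show "g \<in> {\<lambda>x. A *v x + b | A b. rotation_matrix A}"
    by blast
next
  fix g :: "real^3 \<Rightarrow> real^3" assume "g \<in> {\<lambda>x. A *v x + b | A b. rotation_matrix A}"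
  then obtain A b where g: "g = (\<lambda>x. A *v x + b)" and A: "rotation_matrix A"
    by blast
  have "orthogonal_transformation ((*v) A)"
    using A by (simp add: orthogonal_transformation_matrix rotation_matrix_def)
  then show "g \<in> rigid_motions"
    using A unfolding orthogonal_transformation_isometry
    by (auto simp: rigid_motions_def g rotation_matrix_def)
qed

definition config_class :: "real^3^6 \<Rightarrow> (real^3^6) set" where
  "config_class P = {(\<chi> i. g (P $ i)) | g. g \<in> rigid_motions}"

definition quotient_topology :: "'a topology \<Rightarrow> ('a \<Rightarrow> 'b) \<Rightarrow> 'b topology" where
  "quotient_topology X f =
    topology (\<lambda>U. U \<subseteq> f ` topspace X \<and> openin X {x \<in> topspace X. f x \<in> U})"

lemma openin_quotient_topology:
  "openin (quotient_topology X f) U \<longleftrightarrow>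
    U \<subseteq> f ` topspace X \<and> openin X {x \<in> topspace X. f x \<in> U}"
proof -
  have *: "{x \<in> topspace X. f x \<in> S \<inter> T} =
      {x \<in> topspace X. f x \<in> S} \<inter> {x \<in> topspace X. f x \<in> T}" for S T
    by auto
  have **: "{x \<in> topspace X. f x \<in> \<Union>\<K>} = (\<Union>K\<in>\<K>. {x \<in> topspace X. f x \<in> K})" for \<K>
    by auto
  have "istopology (\<lambda>U. U \<subseteq> f ` topspace X \<and> openin X {x \<in> topspace X. f x \<in> U})"
    unfolding istopology_def * ** by (auto intro: openin_Int)
  then show ?thesis
    by (simp add: quotient_topology_def)
qed

lemma quotient_map_quotient_topology: "quotient_map X (quotient_topology X f) f"
proof -
  have "openin (quotient_topology X f) (f ` topspace X)"
    by (auto simp: openin_quotient_topology intro: openin_subopen[THEN iffD2])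
  then have "topspace (quotient_topology X f) = f ` topspace X"
    by (metis openin_quotient_topology openin_subset openin_topspace subset_antisym)
  then show ?thesis
    by (auto simp: quotient_map_def openin_quotient_topology)
qed

definition config_space :: "real \<Rightarrow> (real^3^6) set topology" where
  "config_space \<theta> = quotient_topology (top_of_set (hexagons \<theta>)) config_class"

definition strictly_same_side :: "(real^3) set \<Rightarrow> real^3 \<Rightarrow> real^3 \<Rightarrow> bool" where
  "strictly_same_side H x y \<longleftrightarrow>
    (\<exists>n c. n \<noteq> 0 \<and> H = {z. n \<bullet> z = c} \<and> n \<bullet> x > c \<and> n \<bullet> y > c)"

definition strictly_opposite_sides :: "(real^3) set \<Rightarrow> real^3 \<Rightarrow> real^3 \<Rightarrow> bool" where
  "strictly_opposite_sides H x y \<longleftrightarrow>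
    (\<exists>n c. n \<noteq> 0 \<and> H = {z. n \<bullet> z = c} \<and> n \<bullet> x > c \<and> n \<bullet> y < c)"

text \<open>
  Given the equality of the two edge vectors, the four points are the vertices of a (possibly
  degenerate) parallelogram, which is non-degenerate iff they do not lie on a line.
\<close>

definition base_points :: "real^3^6 \<Rightarrow> 6 \<Rightarrow> (real^3) set" where
  "base_points P i = {P $ (i - 1), P $ (i + 1), P $ (i + 2), P $ (i - 2)}"

definition parallelogram_base :: "real^3^6 \<Rightarrow> 6 \<Rightarrow> bool" where
  "parallelogram_base P i \<longleftrightarrow>
    P $ (i - 2) - P $ (i - 1) = P $ (i + 2) - P $ (i + 1) \<and> \<not> collinear (base_points P i)"

definition boat :: "real^3^6 \<Rightarrow> bool" where
  "boat P \<longleftrightarrow> (\<exists>i. parallelogram_base P i \<and>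
    strictly_same_side (affine hull base_points P i) (P $ i) (P $ (i + 3)))"

definition chair :: "real^3^6 \<Rightarrow> bool" where
  "chair P \<longleftrightarrow> (\<exists>i. parallelogram_base P i \<and>
    strictly_opposite_sides (affine hull base_points P i) (P $ i) (P $ (i + 3)))"

abbreviation circle_space :: "complex topology" where
  "circle_space \<equiv> top_of_set (sphere 0 1)"

abbreviation point_space :: "complex topology" where
  "point_space \<equiv> top_of_set {0}"

definition circles_and_points :: "nat \<Rightarrow> nat \<Rightarrow> (nat \<times> complex) topology" where
  "circles_and_points m n =
    sum_topology (\<lambda>k. if k < m then circle_space else point_space) {..<m + n}"

end

theory Submission
  imports Defs
begin

text \<open>
  The vertices \<open>0, 2, 4\<close> of an equiangular unit hexagon form an equilateral triangle, and so do
  the vertices \<open>3, 5, 1\<close>; both have the same circumradius \<open>r\<close>, and the angle enters only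
  through \<open>\<rho> = 1 / r\<^sup>2\<close>. In the frame of the first triangle, the six remaining edge lengths are
  linear equations which determine the projection of the second triangle to the plane of the
  first one from the position of its centre. What is left are a complex number \<open>u\<close> and a real
  number \<open>z\<close> for the centre, and a complex number \<open>w\<close> for the heights of the second triangle.
  The resulting system is solved by hand. Solutions with \<open>u = 0\<close> are isolated; those with
  \<open>u \<noteq> 0\<close> form one circle, parametrised by the argument of \<open>w\<close>, if \<open>1 < \<rho> < 3\<close>, and two
  circles, distinguished by the sign of \<open>z\<close> and parametrised by the argument of \<open>u\<close>, if
  \<open>\<rho> > 3\<close>. Finally \<open>u = 0\<close> holds iff the three long diagonals are equal, which is so for every
  chair and for no boat.
\<close>

section \<open>The algebraic model\<close>

text \<open>With both triangles scaled to circumradius 1, each squared edge length is affine in the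
  six products of \<open>U\<close>, \<open>V\<close> with \<open>e1\<close>, \<open>e2\<close> and
  the shift \<open>t\<close>. The \<open>2\<close> in \<open>kappa\<close> is the sum of the two
  squared circumradii. Only the components along the normal \<open>e1 x e2\<close> stay free; the
  cross product fixes their signs, so the coordinates are invariant under rotations but tell mirror
  images apart. The even triangle supplies a frame for every hexagon with \<open>r > 0\<close>,
  hence a continuous section, and the quotient topology becomes that of a subset of a Euclidean
  space. Angle 0 means \<open>r = 0\<close> and is treated apart. The equation
  \<open>|u| + |kappa| = 1\<close> leaves the sign of \<open>kappa\<close> open. Where
  \<open>u\<close> vanishes both signs can give points; elsewhere the negative sign survives only
  for \<open>\<rho> = 3\<close>. The choice of parameter on the circles avoids zeros: for
  \<open>u \<noteq> 0\<close>, \<open>w\<close> vanishes only if \<open>|u| = 1\<close>, where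
  \<open>\<rho> = 3 + z^2\<close>, so its argument is available for \<open>\<rho> < 3\<close>;
  \<open>z = 0\<close> forces \<open>\<rho> = 1 + |u| + |u|^2\<close>, so the sign of
  \<open>z\<close> is available for \<open>\<rho> > 3\<close>.\<close>

text \<open>
  All lengths are divided by \<open>r\<close>. The second triangle has centre \<open>(Re u, Im u, z)\<close> relative to
  the first, and its plane is spanned by orthonormal vectors \<open>U, V\<close> with third coordinates
  \<open>Re w, Im w\<close>. Their other coordinates are affine in \<open>u\<close> and \<open>kappa\<close> by the edge equations
  (see \<open>model_U\<close> and \<open>model_V\<close> below). The first two equations of the model say that
  \<open>U, V\<close> are orthonormal, the third one expresses the remaining edge equations.
\<close>

definition kappa :: "real \<Rightarrow> complex \<Rightarrow> real \<Rightarrow> real" where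
  "kappa \<rho> u z = 2 + (cmod u)\<^sup>2 + z\<^sup>2 - \<rho>"

definition model :: "real \<Rightarrow> (complex \<times> real \<times> complex) set" where
  "model \<rho> = {(u, z, w). w\<^sup>2 = 4 * kappa \<rho> u z * cnj u \<and> cmod u + \<bar>kappa \<rho> u z\<bar> = 1 \<and>
      z * w = (kappa \<rho> u z - 1) * u - (cnj u)\<^sup>2}"

lemma modelD:
  fixes u w :: complex
  assumes "(u, z, w) \<in> model \<rho>"
  shows "w\<^sup>2 = 4 * kappa \<rho> u z * cnj u" "cmod u + \<bar>kappa \<rho> u z\<bar> = 1"
    "z * w = (kappa \<rho> u z - 1) * u - (cnj u)\<^sup>2"
  using assms by (auto simp: model_def)

lemma cmod_cube_sum:
  fixes u :: complex
  shows "(Re (u ^ 3))\<^sup>2 + (Im (u ^ 3))\<^sup>2 = (cmod u) ^ 6"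
proof -
  have "(Re (u ^ 3))\<^sup>2 + (Im (u ^ 3))\<^sup>2 = (cmod (u ^ 3))\<^sup>2"
    by (simp only: cmod_power2)
  also have "\<dots> = (cmod u) ^ 6"
    by (simp add: norm_power flip: power_mult)
  finally show ?thesis .
qed

text \<open>Squaring the third equation and multiplying by \<open>u\<close> eliminates
  \<open>w\<close> through the first one. What remains involves only \<open>|u|\<close>,
  \<open>z\<close> and \<open>u^3\<close>; the two claims are its real and imaginary parts.\<close>

lemma model_cube:
  fixes u w :: complex
  assumes "(u, z, w) \<in> model \<rho>"
  defines "k \<equiv> kappa \<rho> u z"
  shows "4 * z\<^sup>2 * k * (cmod u)\<^sup>2 = ((k - 1)\<^sup>2 + (cmod u)\<^sup>2) * Re (u ^ 3) - 2 * (k - 1) * (cmod u) ^ 4"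
    and "((k - 1)\<^sup>2 - (cmod u)\<^sup>2) * Im (u ^ 3) = 0"
proof -
  note m = modelD[OF assms(1), folded k_def]
  have N: "u * cnj u = of_real ((cmod u)\<^sup>2)"
    by (simp only: complex_norm_square)
  have "of_real (z\<^sup>2) * w\<^sup>2 * u = (z * w)\<^sup>2 * u"
    by (simp add: power2_eq_square)
  also have "\<dots> = ((k - 1) * u - (cnj u)\<^sup>2)\<^sup>2 * u"
    by (simp add: m(3))
  also have "\<dots> = (k - 1)\<^sup>2 * u ^ 3 - 2 * (k - 1) * (u * cnj u)\<^sup>2 + (u * cnj u) * cnj u ^ 3"
    by (simp add: power2_eq_square power3_eq_cube algebra_simps)
  finally have "of_real (z\<^sup>2) * w\<^sup>2 * u = (k - 1)\<^sup>2 * u ^ 3 - 2 * (k - 1) * (u * cnj u)\<^sup>2 + (u * cnj u) * cnj (u ^ 3)"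
    by simp
  moreover have "of_real (z\<^sup>2) * w\<^sup>2 * u = of_real (4 * z\<^sup>2 * k) * (u * cnj u)"
    by (simp add: m(1))
  ultimately have "of_real (4 * z\<^sup>2 * k) * (u * cnj u) = (k - 1)\<^sup>2 * u ^ 3 - 2 * (k - 1) * (u * cnj u)\<^sup>2
      + (u * cnj u) * cnj (u ^ 3)"
    by simp
  then have E: "of_real (4 * z\<^sup>2 * k * (cmod u)\<^sup>2) = of_real ((k - 1)\<^sup>2) * u ^ 3
      - of_real (2 * (k - 1) * (cmod u) ^ 4) + of_real ((cmod u)\<^sup>2) * cnj (u ^ 3)"
    unfolding N by (simp flip: power_mult)
  show "4 * z\<^sup>2 * k * (cmod u)\<^sup>2 = ((k - 1)\<^sup>2 + (cmod u)\<^sup>2) * Re (u ^ 3) - 2 * (k - 1) * (cmod u) ^ 4"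
    using arg_cong[OF E, of Re] unfolding Re_complex_of_real minus_complex.sel plus_complex.sel
      times_complex.sel cnj.sel Im_complex_of_real by (simp add: algebra_simps)
  show "((k - 1)\<^sup>2 - (cmod u)\<^sup>2) * Im (u ^ 3) = 0"
    using arg_cong[OF E, of Im] unfolding Im_complex_of_real minus_complex.sel plus_complex.sel
      times_complex.sel cnj.sel Re_complex_of_real by (auto simp: algebra_simps)
qed

text \<open>A negative \<open>kappa\<close> forces \<open>u\<^sup>3 = - \<bar>u\<bar>\<^sup>3\<close> and then \<open>\<rho> = 3\<close>, the excluded angle \<open>\<pi> / 3\<close>.\<close>

lemma model_kappa_nonneg:
  fixes u w :: complex
  assumes "(u, z, w) \<in> model \<rho>" "u \<noteq> 0" "\<rho> \<noteq> 3"
  shows "kappa \<rho> u z \<ge> 0"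
proof (rule ccontr)
  define p k where "p = cmod u" and "k = kappa \<rho> u z"
  assume "\<not> kappa \<rho> u z \<ge> 0"
  then have k: "k = p - 1" "p < 1" "p > 0"
    using modelD(2)[OF assms(1)] assms(2) by (auto simp: p_def k_def)
  note c = model_cube[OF assms(1), folded p_def k_def]
  \<comment> \<open>This factor is nonzero since \<open>p < 1\<close>, so \<open>u^3\<close> is real
    and equals \<open>p^3\<close> or \<open>- p^3\<close>.\<close>
  have "(k - 1)\<^sup>2 - p\<^sup>2 = 4 * (1 - p)"
    unfolding k by (simp add: power2_eq_square algebra_simps)
  with c(2) k have "Im (u ^ 3) = 0"
    by auto
  with cmod_cube_sum[of u] have "(Re (u ^ 3))\<^sup>2 = (p ^ 3)\<^sup>2"
    by (simp add: p_def flip: power_mult)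
  then consider "Re (u ^ 3) = p ^ 3" | "Re (u ^ 3) = - (p ^ 3)"
    using power2_eq_iff by blast
  then show False
  proof cases
    case 1
    have "4 * z\<^sup>2 * k * p\<^sup>2 \<le> 0"
      using k by (intro mult_nonpos_nonneg mult_nonneg_nonpos) auto
    moreover have "((k - 1)\<^sup>2 + p\<^sup>2) * p ^ 3 - 2 * (k - 1) * p ^ 4 > 0"
    proof -
      have "((k - 1)\<^sup>2 + p\<^sup>2) * p ^ 3 > 0"
        using k by (intro mult_pos_pos add_nonneg_pos) auto
      moreover have "(k - 1) * p ^ 4 \<le> 0"
        using k by (intro mult_nonpos_nonneg) auto
      ultimately show ?thesis by linarith
    qed
    ultimately show False
      using c(1) 1 by simp
  next
    case 2
    have "4 * z\<^sup>2 * (p - 1) * p\<^sup>2 = ((p - 1 - 1)\<^sup>2 + p\<^sup>2) * - (p ^ 3) - 2 * (p - 1 - 1) * p ^ 4"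
      using c(1)[unfolded 2 k] .
    moreover have "((p - 1 - 1)\<^sup>2 + p\<^sup>2) * - (p ^ 3) - 2 * (p - 1 - 1) * p ^ 4
        = - ((4 * p\<^sup>2 * (1 - p)) * (p * (1 - p)))"
      by (simp add: power2_eq_square power3_eq_cube power4_eq_xxxx algebra_simps)
    ultimately have "(4 * p\<^sup>2 * (1 - p)) * z\<^sup>2 = (4 * p\<^sup>2 * (1 - p)) * (p * (1 - p))"
      by (simp add: algebra_simps)
    then have "z\<^sup>2 = p * (1 - p)"
      using k by simp
    \<comment> \<open>Now the definition of \<open>kappa\<close> reads
      \<open>k = 2 + p - \<rho>\<close>, to be compared with \<open>k = p - 1\<close>.\<close>
    then have "\<rho> = 3"
      using k unfolding k_def kappa_def p_def[symmetric] by (simp add: power2_eq_square algebra_simps)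
    with assms show False by simp
  qed
qed

text \<open>For \<open>k = 1 - |u|\<close> the factor \<open>(k - 1)^2 - |u|^2\<close> in
  \<open>model_cube\<close> vanishes, so the imaginary part imposes nothing and the real part gives
  \<open>z^2\<close>. Inserting this into the formula for \<open>\<rho>\<close> removes
  \<open>z\<close>; the result yields the lower bound on \<open>|u|\<close> below.\<close>

lemma model_nonzero:
  fixes u w :: complex
  assumes "(u, z, w) \<in> model \<rho>" "u \<noteq> 0" "\<rho> \<noteq> 3"
  shows "kappa \<rho> u z = 1 - cmod u"
    and "0 < cmod u" "cmod u \<le> 1"
    and "\<rho> = 1 + cmod u + (cmod u)\<^sup>2 + z\<^sup>2"
    and "(1 - cmod u) * z\<^sup>2 = (Re (u ^ 3) + cmod u ^ 3) / 2"
    and "\<rho> * (1 - cmod u) = 1 - (cmod u ^ 3 - Re (u ^ 3)) / 2"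
    and "w\<^sup>2 = 4 * (1 - cmod u) * cnj u"
    and "z * w = - cmod u * u - (cnj u)\<^sup>2"
proof -
  note m = modelD[OF assms(1)]
  show k: "kappa \<rho> u z = 1 - cmod u"
    using m(2) model_kappa_nonneg[OF assms] by simp
  show p: "0 < cmod u" "cmod u \<le> 1"
    using m(2) assms(2) by auto
  show r: "\<rho> = 1 + cmod u + (cmod u)\<^sup>2 + z\<^sup>2"
    using k by (simp add: kappa_def)
  have "(4 * (cmod u)\<^sup>2) * ((1 - cmod u) * z\<^sup>2) = 4 * z\<^sup>2 * (1 - cmod u) * (cmod u)\<^sup>2"
    by simp
  also have "\<dots> = (4 * (cmod u)\<^sup>2) * ((Re (u ^ 3) + cmod u ^ 3) / 2)"
    unfolding model_cube(1)[OF assms(1), unfolded k]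
    by (simp add: power2_eq_square power3_eq_cube power4_eq_xxxx algebra_simps)
  finally have "(4 * (cmod u)\<^sup>2) * ((1 - cmod u) * z\<^sup>2) = (4 * (cmod u)\<^sup>2) * ((Re (u ^ 3) + cmod u ^ 3) / 2)" .
  then show z: "(1 - cmod u) * z\<^sup>2 = (Re (u ^ 3) + cmod u ^ 3) / 2"
    using p by simp
  have poly: "(1 + p + p\<^sup>2) * (1 - p) + (R + p ^ 3) / 2 = 1 - (p ^ 3 - R) / 2" for p R :: real
    by (simp add: power2_eq_square power3_eq_cube field_simps)
  have "\<rho> * (1 - cmod u) = (1 + cmod u + (cmod u)\<^sup>2) * (1 - cmod u) + (1 - cmod u) * z\<^sup>2"
    by (subst r) (simp add: algebra_simps)
  also have "\<dots> = 1 - (cmod u ^ 3 - Re (u ^ 3)) / 2"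
    unfolding z using poly[of "cmod u" "Re (u ^ 3)"] .
  finally show "\<rho> * (1 - cmod u) = 1 - (cmod u ^ 3 - Re (u ^ 3)) / 2" .
  show "w\<^sup>2 = 4 * (1 - cmod u) * cnj u" "z * w = - cmod u * u - (cnj u)\<^sup>2"
    using m k by auto
qed

text \<open>This bound keeps the solutions with \<open>u \<noteq> 0\<close> away from those with
  \<open>u = 0\<close>, so the latter cannot be their limits when \<open>\<rho> > 1\<close>.\<close>

lemma model_cmod_ge:
  fixes u w :: complex
  assumes "(u, z, w) \<in> model \<rho>" "u \<noteq> 0" "\<rho> \<noteq> 3"
  shows "\<rho> > 1" "cmod u \<ge> 1 - 1 / \<rho>"
proof -
  note n = model_nonzero[OF assms]
  show r: "\<rho> > 1"
    using n(2,4) zero_le_power2[of z] zero_le_power2[of "cmod u"] by linarith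
  have "Re (u ^ 3) \<le> cmod u ^ 3"
    using complex_Re_le_cmod[of "u ^ 3"] by (simp only: norm_power)
  then have "\<rho> * (1 - cmod u) \<le> 1"
    using n(6) by simp
  then show "cmod u \<ge> 1 - 1 / \<rho>"
    using r by (simp add: field_simps)
qed

text \<open>The two alternatives are \<open>kappa = 1\<close> and \<open>kappa = - 1\<close>. In the
  first the odd triangle is a translate of the even one turned by a half turn about the common axis
  (an antiprism); in the second it lies parallel above it, vertex 3 over vertex 0 (a prism).\<close>

lemma model_zero_iff:
  fixes w :: complex
  assumes "\<rho> \<ge> 1"
  shows "(0, z, w) \<in> model \<rho> \<longleftrightarrow> w = 0 \<and> (z\<^sup>2 = \<rho> - 1 \<or> z\<^sup>2 = \<rho> - 3)"
  by (auto simp: model_def kappa_def)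

lemma model_empty:
  assumes "\<rho> < 1"
  shows "model \<rho> = {}"
proof -
  have False if m: "(u, z, w) \<in> model \<rho>" for u z and w :: complex
  proof (cases "u = 0")
    case True
    then have "\<bar>2 + z\<^sup>2 - \<rho>\<bar> = 1"
      using modelD(2)[OF m] by (simp add: kappa_def)
    then show False
      using assms zero_le_power2[of z] by linarith
  next
    case False
    then show False
      using model_cmod_ge(1)[OF m] assms by linarith
  qed
  then show ?thesis
    by (metis ex_in_conv prod_cases3)
qed

lemma model_1: "model 1 = {(0, 0, 0)}"
proof -
  have "(u, z, w) = (0, 0, 0)" if m: "(u, z, w) \<in> model 1" for u z and w :: complex
  proof -
    have "u = 0"
      using model_cmod_ge(1)[OF m] by linarith
    then have w: "w = 0" and "z\<^sup>2 = 0 \<or> z\<^sup>2 = - 2"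
      using m model_zero_iff[of 1 z w] by simp_all
    then have "z\<^sup>2 = 0"
      using zero_le_power2[of z] by linarith
    with \<open>u = 0\<close> w show ?thesis
      by simp
  qed
  moreover have "(0, 0, 0) \<in> model 1"
    using model_zero_iff[of 1 0 0] by simp
  ultimately show ?thesis
    by (intro equalityI subsetI) (metis prod_cases3 singletonI, simp)
qed

section \<open>Disjoint unions of clopen pieces\<close>

lemma homeomorphic_space_sum_topology:
  assumes X: "topspace X = (\<Union>k\<in>I. U k)"
    and disj: "disjoint_family_on U I"
    and op: "\<And>k. k \<in> I \<Longrightarrow> openin X (U k)"
    and hom: "\<And>k. k \<in> I \<Longrightarrow> subtopology X (U k) homeomorphic_space Y k"
  shows "X homeomorphic_space sum_topology Y I"
proof -
  have "\<exists>g. homeomorphic_map (Y k) (subtopology X (U k)) g" if "k \<in> I" for k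
    using hom[OF that] homeomorphic_space homeomorphic_space_sym by blast
  then obtain g where g: "\<And>k. k \<in> I \<Longrightarrow> homeomorphic_map (Y k) (subtopology X (U k)) (g k)"
    by metis
  have sub: "U k \<subseteq> topspace X" if "k \<in> I" for k
    using X that by blast
  have im: "g k ` topspace (Y k) = U k" if "k \<in> I" for k
    using homeomorphic_imp_surjective_map[OF g[OF that]] sub[OF that] by auto
  have inj: "inj_on (g k) (topspace (Y k))" if "k \<in> I" for k
    using homeomorphic_imp_injective_map[OF g[OF that]] .
  define h where "h = (\<lambda>(k, y). g k y)"
  have "homeomorphic_map (sum_topology Y I) X h"
  proof (rule bijective_open_imp_homeomorphic_map)
    show "continuous_map (sum_topology Y I) X h"
      unfolding continuous_map_def
    proof (intro conjI allI impI)
      show "h \<in> topspace (sum_topology Y I) \<rightarrow> topspace X"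
        unfolding X using im by (fastforce simp: h_def)
    next
      fix V assume V: "openin X V"
      have "openin (Y k) {x. (k, x) \<in> {x \<in> topspace (sum_topology Y I). h x \<in> V}}" if k: "k \<in> I" for k
      proof -
        have "openin (Y k) {x \<in> topspace (Y k). g k x \<in> V \<inter> U k}"
          using homeomorphic_imp_continuous_map[OF g[OF k]] V
          by (intro openin_continuous_map_preimage[where Y = "subtopology X (U k)"])
            (auto simp: openin_subtopology)
        also have "{x \<in> topspace (Y k). g k x \<in> V \<inter> U k} =
            {x. (k, x) \<in> {x \<in> topspace (sum_topology Y I). h x \<in> V}}"
          using im[OF k] k by (auto simp: h_def)
        finally show ?thesis .
      qed
      then show "openin (sum_topology Y I) {x \<in> topspace (sum_topology Y I). h x \<in> V}"
        by (auto simp: openin_sum_topology)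
    qed
    show "open_map (sum_topology Y I) X h"
      unfolding open_map_def
    proof (intro allI impI)
      fix W assume W: "openin (sum_topology Y I) W"
      then have "W \<subseteq> Sigma I (topspace \<circ> Y)" and W': "\<And>k. k \<in> I \<Longrightarrow> openin (Y k) {x. (k, x) \<in> W}"
        by (auto simp: openin_sum_topology)
      then have "h ` W = (\<Union>k\<in>I. g k ` {x. (k, x) \<in> W})"
        unfolding h_def by fastforce
      moreover have "openin X (g k ` {x. (k, x) \<in> W})" if k: "k \<in> I" for k
        using homeomorphic_imp_open_map[OF g[OF k]] W'[OF k] op[OF k]
        unfolding open_map_def using openin_trans_full by blast
      ultimately show "openin X (h ` W)"
        by auto
    qed
    have "h ` topspace (sum_topology Y I) = (\<Union>k\<in>I. g k ` topspace (Y k))"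
      unfolding h_def by fastforce
    then show "h ` topspace (sum_topology Y I) = topspace X"
      using im X by simp
    show "inj_on h (topspace (sum_topology Y I))"
    proof (rule inj_onI, clarsimp)
      fix j x k y
      assume a: "j \<in> I" "x \<in> topspace (Y j)" "k \<in> I" "y \<in> topspace (Y k)" "h (j, x) = h (k, y)"
      then have "h (j, x) \<in> g j ` topspace (Y j)" "h (j, x) \<in> g k ` topspace (Y k)"
        by (metis h_def case_prod_conv imageI)+
      then have "h (j, x) \<in> U j" "h (j, x) \<in> U k"
        using im a by simp_all
      with disj a have "j = k"
        by (auto simp: disjoint_family_on_def)
      with a inj[of k] show "j = k \<and> x = y"
        by (auto simp: h_def dest: inj_onD)
    qed
  qed
  then show ?thesis
    using homeomorphic_map_imp_homeomorphic_space homeomorphic_space_sym by blast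
qed

lemma clopen_connected_in_connected_components_of:
  assumes "openin X C" "closedin X C" "connectedin X C" "C \<noteq> {}"
  shows "C \<in> connected_components_of X"
proof -
  obtain x where x: "x \<in> C"
    using assms by auto
  then have xX: "x \<in> topspace X"
    using assms openin_subset by blast
  have "C \<subseteq> connected_component_of_set X x"
    using assms x by (simp add: connected_component_of_maximal)
  moreover have "connected_component_of_set X x \<subseteq> C"
  proof -
    have "x \<in> connected_component_of_set X x"
      using xX by (simp add: connected_component_of_refl)
    then have "\<not> disjnt (connected_component_of_set X x) C"
      using x by (auto simp: disjnt_def)
    then show ?thesis
      using connectedin_clopen_cases[OF connectedin_connected_component_of assms(2,1)] by blast
  qed
  ultimately show ?thesis
    using xX by (auto simp: connected_components_of_def)
qed

lemma singleton_homeomorphic_point_space: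
  "a \<in> topspace X \<Longrightarrow> subtopology X {a} homeomorphic_space point_space"
  unfolding homeomorphic_space_def homeomorphic_maps_def
  by (rule exI[of _ "\<lambda>_. 0"], rule exI[of _ "\<lambda>_. a"]) (auto simp: continuous_map_into_subtopology)

text \<open>A continuous bijection from a compact space to a Hausdorff space is a homeomorphism.
  Hence a circle of solutions only requires that each point of the unit circle has exactly one
  preimage.\<close>

lemma compact_homeomorphic_circle_space:
  fixes f :: "'a::topological_space \<Rightarrow> complex"
  assumes "compact S" "continuous_on S f" "inj_on f S" "f ` S = sphere 0 1"
  shows "top_of_set S homeomorphic_space circle_space"
proof -
  have "homeomorphic_map (top_of_set S) circle_space f"
    using assms by (intro continuous_imp_homeomorphic_map)
      (auto simp: compact_space_subtopology Hausdorff_space_subtopology)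
  then show ?thesis
    by (rule homeomorphic_map_imp_homeomorphic_space)
qed

lemma connectedin_homeomorphic_circle_space:
  assumes "C \<subseteq> topspace X" "subtopology X C homeomorphic_space circle_space"
  shows "connectedin X C"
proof -
  have "connected (sphere (0::complex) 1)"
    by (simp add: connected_sphere)
  then have "connected_space circle_space"
    by (simp add: connected_space_subtopology)
  with assms show ?thesis
    by (simp add: connectedin_def homeomorphic_connected_space)
qed

text \<open>The other pieces are finitely many closed sets, so their union is closed and its
  complement open. Compactness of the pieces thus yields that they are clopen.\<close>

lemma closed_partition_openin:
  assumes "finite I" "topspace X = (\<Union>k\<in>I. U k)" "disjoint_family_on U I"
    and "\<And>k. k \<in> I \<Longrightarrow> closedin X (U k)" "k \<in> I"
  shows "openin X (U k)"
proof -
  have "closedin X (\<Union>j\<in>I - {k}. U j)"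
    using assms by (intro closedin_Union) auto
  moreover have "topspace X - (\<Union>j\<in>I - {k}. U j) = U k"
    using assms(2,3,5) by (auto simp: disjoint_family_on_def)
  ultimately show ?thesis
    by (metis openin_diff openin_topspace)
qed

lemma circles_and_points_decomposition:
  fixes S :: "'a::t2_space set"
  assumes S: "S = (\<Union>k<m + n. U k)" and disj: "disjoint_family_on U {..<m + n}"
    and circ: "\<And>k. k < m \<Longrightarrow> compact (U k) \<and> top_of_set (U k) homeomorphic_space circle_space"
    and pt: "\<And>k. m \<le> k \<Longrightarrow> k < m + n \<Longrightarrow> \<exists>a. U k = {a}"
  shows "top_of_set S homeomorphic_space circles_and_points m n"
    and "k < m \<Longrightarrow> U k \<in> connected_components_of (top_of_set S)"
    and "m \<le> k \<Longrightarrow> k < m + n \<Longrightarrow> openin (top_of_set S) (U k)"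
proof -
  have sub: "U k \<subseteq> S" if "k < m + n" for k
    using that S by auto
  have cl: "closedin (top_of_set S) (U k)" if "k < m + n" for k
  proof -
    have "closed (U k)"
      using circ[of k] pt[of k] that compact_imp_closed by (cases "k < m") (auto simp: not_less)
    then show ?thesis
      using sub[OF that] by (simp add: closed_subset)
  qed
  have op: "openin (top_of_set S) (U k)" if "k < m + n" for k
    by (rule closed_partition_openin[where I = "{..<m + n}"]) (use S disj cl that in auto)
  have subtop: "subtopology (top_of_set S) (U k) = top_of_set (U k)" if "k < m + n" for k
    using sub[OF that] by (simp add: subtopology_subtopology inf.absorb2)
  show "top_of_set S homeomorphic_space circles_and_points m n"
    unfolding circles_and_points_def
  proof (rule homeomorphic_space_sum_topology[where U = U])
    show "topspace (top_of_set S) = (\<Union>k\<in>{..<m + n}. U k)"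
      using S by simp
    fix k assume k: "k \<in> {..<m + n}"
    then show "openin (top_of_set S) (U k)"
      using op by simp
    show "subtopology (top_of_set S) (U k) homeomorphic_space (if k < m then circle_space else point_space)"
    proof (cases "k < m")
      case False
      with k pt[of k] obtain a where "U k = {a}"
        by auto
      then show ?thesis
        using False sub[of k] k by (auto intro!: singleton_homeomorphic_point_space)
    qed (use circ subtop k in auto)
  qed (rule disj)
  show "U k \<in> connected_components_of (top_of_set S)" if "k < m"
  proof (rule clopen_connected_in_connected_components_of)
    have h: "subtopology (top_of_set S) (U k) homeomorphic_space circle_space"
      using circ subtop that by simp
    then show "connectedin (top_of_set S) (U k)"
      using sub that by (intro connectedin_homeomorphic_circle_space) auto
    show "U k \<noteq> {}"
    proof
      assume "U k = {}"
      then have "circle_space = (trivial_topology :: complex topology)"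
        using homeomorphic_empty_space[OF h] by simp
      then have "sphere (0::complex) 1 = {}"
        by (metis topspace_discrete_topology topspace_euclidean_subtopology)
      then show False
        by simp
    qed
  qed (use op cl that in auto)
  show "openin (top_of_set S) (U k)" if "k < m + n"
    using op that .
qed

section \<open>Topology of the model\<close>

text \<open>
  For \<open>u \<noteq> 0\<close> the modulus \<open>p = \<bar>u\<bar>\<close> is the solution of the following equation, in which
  \<open>E \<in> [0, 1]\<close> depends only on the point of the circle and \<open>z\<^sup>2 = \<rho> - 1 - p - p\<^sup>2\<close>.
\<close>

lemma radius_unique:
  fixes p q E \<rho> :: real
  assumes "0 \<le> E" "0 \<le> p" "p \<le> 1" "0 \<le> q" "q \<le> 1"
    and "(1 - p) * (\<rho> - 1 - p - p\<^sup>2) = p ^ 3 * E" "0 \<le> \<rho> - 1 - p - p\<^sup>2"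
    and "(1 - q) * (\<rho> - 1 - q - q\<^sup>2) = q ^ 3 * E" "0 \<le> \<rho> - 1 - q - q\<^sup>2"
  shows "p = q"
proof -
  have False
    if "0 \<le> p" "p < q" "q \<le> 1"
      and p: "(1 - p) * (\<rho> - 1 - p - p\<^sup>2) = p ^ 3 * E"
      and q: "(1 - q) * (\<rho> - 1 - q - q\<^sup>2) = q ^ 3 * E" "0 \<le> \<rho> - 1 - q - q\<^sup>2" for p q
  proof -
    have sq: "p\<^sup>2 < q\<^sup>2"
      using that by (intro power_strict_mono) auto
    \<comment> \<open>Both factors on the left of the equation decrease in the radius and the right
      side does not decrease. Strictness comes from \<open>1 - p\<close>, since the other factor at
      \<open>p\<close> exceeds its nonnegative value at \<open>q\<close>.\<close>
    have "(1 - q) * (\<rho> - 1 - q - q\<^sup>2) \<le> (1 - q) * (\<rho> - 1 - p - p\<^sup>2)"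
      using sq that by (intro mult_left_mono) auto
    also have "\<dots> < (1 - p) * (\<rho> - 1 - p - p\<^sup>2)"
      using sq that by (intro mult_strict_right_mono) auto
    also have "\<dots> \<le> q ^ 3 * E"
      unfolding p using that assms(1) by (intro mult_right_mono power_mono) auto
    finally show False
      using q by simp
  qed
  from this[of p q] this[of q p] assms show ?thesis
    by (meson linorder_neq_iff)
qed

text \<open>The difference of the two sides is \<open>\<rho> - 1 > 0\<close> at 0 and nonpositive at
  a point \<open>P\<close> where the left side vanishes, so the intermediate value theorem applies
  on \<open>[0, P]\<close>.\<close>

lemma radius_exists:
  fixes E \<rho> :: real
  assumes "0 \<le> E" "1 < \<rho>"
  obtains p where "0 < p" "p \<le> 1" "(1 - p) * (\<rho> - 1 - p - p\<^sup>2) = p ^ 3 * E" "0 \<le> \<rho> - 1 - p - p\<^sup>2"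
proof -
  \<comment> \<open>\<open>P\<close> is the smaller of 1 and the root of
    \<open>\<rho> - 1 - P - P^2\<close>; to its left the prospective \<open>z^2\<close> stays
    nonnegative.\<close>
  obtain P where P: "0 \<le> P" "P \<le> 1" "0 \<le> \<rho> - 1 - P - P\<^sup>2" "(1 - P) * (\<rho> - 1 - P - P\<^sup>2) = 0"
  proof (cases "\<rho> < 3")
    case True
    have "\<exists>P\<ge>0. P \<le> 1 \<and> \<rho> - 1 - P - P\<^sup>2 = 0"
      by (rule IVT2') (use assms True in \<open>auto intro!: continuous_intros\<close>)
    with that show ?thesis
      by force
  next
    case False
    with that[of 1] show ?thesis
      by auto
  qed
  have "\<exists>p\<ge>0. p \<le> P \<and> (1 - p) * (\<rho> - 1 - p - p\<^sup>2) - p ^ 3 * E = 0"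
    by (rule IVT2') (use assms P in \<open>auto intro!: continuous_intros\<close>)
  then obtain p where p: "0 \<le> p" "p \<le> P" "(1 - p) * (\<rho> - 1 - p - p\<^sup>2) = p ^ 3 * E"
    by auto
  have "p\<^sup>2 \<le> P\<^sup>2"
    using p by (intro power_mono) auto
  then have "0 \<le> \<rho> - 1 - p - p\<^sup>2"
    using p P by linarith
  moreover have "p \<noteq> 0"
    using p(3) assms by auto
  ultimately show ?thesis
    using that[of p] p P by auto
qed

section \<open>Compactness of the solution set\<close>

lemma closed_model: "closed (model \<rho>)"
proof -
  have "model \<rho> = {x. (snd (snd x))\<^sup>2 = 4 * of_real (kappa \<rho> (fst x) (fst (snd x))) * cnj (fst x) \<and>
      cmod (fst x) + \<bar>kappa \<rho> (fst x) (fst (snd x))\<bar> = 1 \<and>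
      of_real (fst (snd x)) * snd (snd x) =
        (of_real (kappa \<rho> (fst x) (fst (snd x))) - 1) * fst x - (cnj (fst x))\<^sup>2}"
    by (auto simp: model_def)
  also have "closed \<dots>"
    unfolding kappa_def by (intro closed_Collect_conj closed_Collect_eq continuous_intros)
  finally show ?thesis .
qed

lemma compact_model: "compact (model \<rho>)"
proof -
  have "norm x \<le> 1 + (1 + \<bar>\<rho>\<bar>) + 2" if "x \<in> model \<rho>" for x
  proof -
    obtain u z and w :: complex where x: "x = (u, z, w)"
      by (cases x rule: prod_cases3)
    note m = modelD[OF that[unfolded x]]
    have u: "cmod u \<le> 1" and k: "\<bar>kappa \<rho> u z\<bar> \<le> 1"
      using m(2) norm_ge_zero[of u] by linarith+
    have "z\<^sup>2 \<le> \<bar>\<rho>\<bar>"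
      using k zero_le_power2[of "cmod u"] unfolding kappa_def by linarith
    also have "\<dots> \<le> (1 + \<bar>\<rho>\<bar>)\<^sup>2"
      by (simp add: power2_eq_square algebra_simps)
    finally have "z\<^sup>2 \<le> (1 + \<bar>\<rho>\<bar>)\<^sup>2" .
    then have z: "\<bar>z\<bar> \<le> 1 + \<bar>\<rho>\<bar>"
      using abs_le_square_iff[of z "1 + \<bar>\<rho>\<bar>"] by simp
    have "(cmod w)\<^sup>2 = cmod (complex_of_real (4 * kappa \<rho> u z) * cnj u)"
      using m(1) by (metis norm_power)
    also have "\<dots> = \<bar>4 * kappa \<rho> u z\<bar> * cmod u"
      by (simp only: norm_mult norm_of_real complex_mod_cnj)
    also have "\<dots> = 4 * (\<bar>kappa \<rho> u z\<bar> * cmod u)"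
      by (simp add: abs_mult)
    also have "\<dots> \<le> 4 * (1 * 1)"
      using u k by (intro mult_left_mono mult_mono) auto
    finally have w: "cmod w \<le> 2"
      using power2_le_imp_le[of "cmod w" 2] by simp
    have "norm x \<le> norm u + (norm z + norm w)"
      unfolding x using norm_Pair_le[of u "(z, w)"] norm_Pair_le[of z w] by linarith
    then show ?thesis
      using u z w by simp
  qed
  then have "bounded (model \<rho>)"
    unfolding bounded_iff by blast
  then show ?thesis
    using closed_model compact_eq_bounded_closed by blast
qed

definition model_nz :: "real \<Rightarrow> (complex \<times> real \<times> complex) set" where
  "model_nz \<rho> = {x \<in> model \<rho>. fst x \<noteq> 0}"

text \<open>The open condition \<open>u \<noteq> 0\<close> is replaced by the closed one
  \<open>1 - 1 / \<rho> \<le> |u|\<close>, which by \<open>model_cmod_ge\<close> selects the same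
  solutions.\<close>

lemma compact_model_nz:
  assumes "1 < \<rho>" "\<rho> \<noteq> 3"
  shows "compact (model_nz \<rho>)"
proof -
  have "model_nz \<rho> = model \<rho> \<inter> {x. 1 - 1 / \<rho> \<le> cmod (fst x)}"
  proof (intro set_eqI iffI)
    fix x assume "x \<in> model_nz \<rho>"
    then show "x \<in> model \<rho> \<inter> {x. 1 - 1 / \<rho> \<le> cmod (fst x)}"
      using model_cmod_ge(2)[of "fst x" "fst (snd x)" "snd (snd x)" \<rho>] assms
      by (simp add: model_nz_def)
  next
    fix x assume "x \<in> model \<rho> \<inter> {x. 1 - 1 / \<rho> \<le> cmod (fst x)}"
    moreover have "1 - 1 / \<rho> > 0"
      using assms by simp
    ultimately show "x \<in> model_nz \<rho>"
      by (auto simp: model_nz_def)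
  qed
  moreover have "closed {x :: complex \<times> real \<times> complex. 1 - 1 / \<rho> \<le> cmod (fst x)}"
    by (intro closed_Collect_le continuous_intros)
  ultimately show ?thesis
    by (simp add: compact_model compact_Int_closed)
qed

section \<open>Parametrising the circles\<close>

lemma model_intro:
  fixes u w :: complex
  assumes "cmod u \<le> 1" "\<rho> = 1 + cmod u + (cmod u)\<^sup>2 + z\<^sup>2"
    and "w\<^sup>2 = 4 * (1 - cmod u) * cnj u" "z * w = - cmod u * u - (cnj u)\<^sup>2"
  shows "(u, z, w) \<in> model \<rho>"
proof -
  have "kappa \<rho> u z = 1 - cmod u"
    using assms(2) by (simp add: kappa_def)
  then show ?thesis
    using assms by (simp add: model_def)
qed

lemma unit_cnj: "cmod e = 1 \<Longrightarrow> e * cnj e = 1"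
  by (simp add: complex_norm_square[symmetric])

text \<open>The double angle formula for \<open>e^3\<close>. It turns \<open>Re (u^3)\<close> into a
  square when \<open>u\<close> has the direction of \<open>(cnj e)^2\<close>.\<close>

lemma Re_power6_unit:
  assumes "cmod e = 1"
  shows "Re (e ^ 6) = 2 * (Re (e ^ 3))\<^sup>2 - 1"
proof -
  have "(Re (e ^ 3))\<^sup>2 + (Im (e ^ 3))\<^sup>2 = 1"
    using assms by (simp add: cmod_cube_sum)
  moreover have "Re (e ^ 6) = Re (e ^ 3 * e ^ 3)"
    by (simp flip: power_add)
  then have "Re (e ^ 6) = (Re (e ^ 3))\<^sup>2 - (Im (e ^ 3))\<^sup>2"
    by (simp only: times_complex.sel power2_eq_square)
  ultimately show ?thesis
    by linarith
qed

text \<open>Here \<open>|u| < 1\<close>, hence \<open>w \<noteq> 0\<close>. Its direction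
  \<open>e\<close> fixes the direction of \<open>u\<close> as \<open>(cnj e)^2\<close>, the radius
  solves the equation above with \<open>E = (Re (e^3))^2\<close>, and \<open>z\<close> follows from
  \<open>z * w\<close>. The direction of \<open>u\<close> alone would leave the sign of
  \<open>w\<close> open.\<close>

lemma model_nz_circle:
  assumes "1 < \<rho>" "\<rho> < 3"
  shows "top_of_set (model_nz \<rho>) homeomorphic_space circle_space"
proof -
  define f :: "complex \<times> real \<times> complex \<Rightarrow> complex" where "f = (\<lambda>x. sgn (snd (snd x)))"
  have w0: "cmod u < 1" "w \<noteq> 0"
    and polar: "w = complex_of_real (2 * sqrt (cmod u * (1 - cmod u))) * sgn w" "u = cmod u * (cnj (sgn w))\<^sup>2"
    and rad: "(1 - cmod u) * (\<rho> - 1 - cmod u - (cmod u)\<^sup>2) = cmod u ^ 3 * (Re (sgn w ^ 3))\<^sup>2"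
    if "(u, z, w) \<in> model_nz \<rho>" for u z and w :: complex
  proof -
    have u: "u \<noteq> 0" and mem: "(u, z, w) \<in> model \<rho>"
      using that by (auto simp: model_nz_def)
    then have n: "(u, z, w) \<in> model \<rho>" "u \<noteq> 0" "\<rho> \<noteq> 3"
      using assms by auto
    note n = model_nonzero[OF this]
    show p1: "cmod u < 1"
      using n(3,4) assms by (smt (verit) zero_le_power2 one_power2)
    then show w: "w \<noteq> 0"
      using n(7) u by auto
    have sw: "cmod (sgn w) = 1"
      using w by (simp add: norm_sgn)
    have "(cmod w)\<^sup>2 = cmod (complex_of_real (4 * (1 - cmod u)) * cnj u)"
      unfolding n(7)[symmetric] by (rule norm_power[symmetric])
    also have "\<dots> = \<bar>4 * (1 - cmod u)\<bar> * cmod u"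
      by (simp only: norm_mult norm_of_real complex_mod_cnj)
    finally have cw: "(cmod w)\<^sup>2 = 4 * (cmod u * (1 - cmod u))"
      using p1 by simp
    have "cmod w = sqrt ((cmod w)\<^sup>2)"
      by simp
    also have "\<dots> = 2 * sqrt (cmod u * (1 - cmod u))"
      unfolding cw by (simp only: real_sqrt_mult[of 4]) simp
    finally have cw': "cmod w = 2 * sqrt (cmod u * (1 - cmod u))" .
    have ws: "w = complex_of_real (cmod w) * sgn w"
      using w by (simp add: sgn_div_norm scaleR_conv_of_real)
    then show "w = complex_of_real (2 * sqrt (cmod u * (1 - cmod u))) * sgn w"
      unfolding cw' .
    have "complex_of_real ((cmod w)\<^sup>2) * (sgn w)\<^sup>2 = w\<^sup>2"
      by (subst (3) ws) (simp add: power_mult_distrib)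
    also have "\<dots> = complex_of_real (4 * (1 - cmod u)) * cnj u"
      using n(7) by simp
    finally have "complex_of_real (4 * (1 - cmod u)) * (complex_of_real (cmod u) * (sgn w)\<^sup>2) 
        = complex_of_real (4 * (1 - cmod u)) * cnj u"
      unfolding cw by (simp add: algebra_simps)
    moreover have "complex_of_real (4 * (1 - cmod u)) \<noteq> 0"
      using p1 by (simp only: of_real_eq_0_iff) simp
    ultimately have "cnj u = complex_of_real (cmod u) * (sgn w)\<^sup>2"
      by (metis mult_left_cancel)
    then have "cnj (cnj u) = cnj (complex_of_real (cmod u) * (sgn w)\<^sup>2)"
      by (rule arg_cong)
    then show us: "u = cmod u * (cnj (sgn w))\<^sup>2"
      by simp
    have "u ^ 3 = complex_of_real (cmod u ^ 3) * cnj (sgn w ^ 6)"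
      by (subst us) (simp add: power_mult_distrib flip: power_mult)
    then have "Re (u ^ 3) = cmod u ^ 3 * Re (sgn w ^ 6)"
      by (metis Re_complex_of_real cnj.sel(1) Im_complex_of_real diff_zero mult_zero_left times_complex.sel(1))
    then have "Re (u ^ 3) = cmod u ^ 3 * (2 * (Re (sgn w ^ 3))\<^sup>2 - 1)"
      using Re_power6_unit[OF sw] by simp
    with n(5) have "(1 - cmod u) * z\<^sup>2 = cmod u ^ 3 * (Re (sgn w ^ 3))\<^sup>2"
      by (simp add: algebra_simps)
    moreover have "z\<^sup>2 = \<rho> - 1 - cmod u - (cmod u)\<^sup>2"
      using n(4) by simp
    ultimately show "(1 - cmod u) * (\<rho> - 1 - cmod u - (cmod u)\<^sup>2) = cmod u ^ 3 * (Re (sgn w ^ 3))\<^sup>2"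
      by simp
  qed
  show ?thesis
  proof (rule compact_homeomorphic_circle_space[of _ f])
    show "compact (model_nz \<rho>)"
      using assms by (intro compact_model_nz) auto
    have "snd (snd x) \<noteq> 0" if "x \<in> model_nz \<rho>" for x
      using w0(2)[of "fst x" "fst (snd x)" "snd (snd x)"] that by simp
    then show "continuous_on (model_nz \<rho>) f"
      unfolding f_def by (intro continuous_intros) auto
    show "inj_on f (model_nz \<rho>)"
    proof (rule inj_onI, clarify)
      fix u z and w :: complex and u' z' and w' :: complex
      assume x: "(u, z, w) \<in> model_nz \<rho>" and x': "(u', z', w') \<in> model_nz \<rho>"
        and "f (u, z, w) = f (u', z', w')"
      then have s: "sgn w = sgn w'"
        by (simp add: f_def)
      have m: "(u, z, w) \<in> model \<rho>" "u \<noteq> 0" "\<rho> \<noteq> 3" and m': "(u', z', w') \<in> model \<rho>" "u' \<noteq> 0" "\<rho> \<noteq> 3"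
        using x x' assms by (auto simp: model_nz_def)
      note n = model_nonzero[OF m] and n' = model_nonzero[OF m']
      have pos: "0 \<le> \<rho> - 1 - cmod u - (cmod u)\<^sup>2" "0 \<le> \<rho> - 1 - cmod u' - (cmod u')\<^sup>2"
        using n(4) n'(4) zero_le_power2[of z] zero_le_power2[of z'] by linarith+
      have p: "cmod u = cmod u'"
        by (rule radius_unique[where E = "(Re (sgn w ^ 3))\<^sup>2" and \<rho> = \<rho>])
          (use rad[OF x] rad[OF x'] pos n(3) n'(3) s in auto)
      have u: "u = u'" and w: "w = w'"
        using polar[OF x] polar[OF x'] s p by auto
      have "z * w = z' * w"
        using n(8) n'(8) u w by simp
      then show "(u = u') \<and> (z, w) = (z', w')"
        using w0(2)[OF x] u w by simp
    qed
    show "f ` model_nz \<rho> = sphere 0 1"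
    proof (intro equalityI subsetI)
      fix e assume "e \<in> f ` model_nz \<rho>"
      then show "e \<in> sphere 0 1"
        using w0(2) by (auto simp: f_def norm_sgn)
    next
      fix e :: complex assume "e \<in> sphere 0 1"
      then have e: "cmod e = 1" and ee: "e * cnj e = 1"
        by (auto simp: unit_cnj)
      obtain p where p: "0 < p" "p \<le> 1" "(1 - p) * (\<rho> - 1 - p - p\<^sup>2) = p ^ 3 * (Re (e ^ 3))\<^sup>2"
          "0 \<le> \<rho> - 1 - p - p\<^sup>2"
        using radius_exists[of "(Re (e ^ 3))\<^sup>2" \<rho>] assms by auto
      have p1: "p < 1"
        using p(2,4) assms(2) by (cases "p = 1") auto
      \<comment> \<open>\<open>q\<close> is half of \<open>|w|\<close>, because
        \<open>w^2 = 4 * (1 - p) * cnj u\<close> with \<open>|u| = p\<close>.\<close>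
      define q where "q = sqrt (p * (1 - p))"
      have q: "q > 0" "q\<^sup>2 = p * (1 - p)"
        using p p1 by (auto simp: q_def)
      \<comment> \<open>With these \<open>u\<close> and \<open>w\<close> the third equation reads
        \<open>z * (2 * q * e) = - p^2 * (e^3 + cnj e^3) * e\<close>, which dictates
        \<open>z\<close>.\<close>
      define u w z where "u = p * (cnj e)\<^sup>2" and "w = 2 * q * e" and "z = - p\<^sup>2 * Re (e ^ 3) / q"
      have cu: "cmod u = p"
        using p e by (simp add: u_def norm_mult norm_power)
      have "z\<^sup>2 = p * (p ^ 3 * (Re (e ^ 3))\<^sup>2) / q\<^sup>2"
        by (simp add: z_def power2_eq_square power3_eq_cube)
      also have "\<dots> = \<rho> - 1 - p - p\<^sup>2"
        unfolding q p(3)[symmetric] using p(1) p1 by simp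
      finally have z: "\<rho> = 1 + p + p\<^sup>2 + z\<^sup>2"
        by simp
      have cq: "complex_of_real q * complex_of_real q = complex_of_real p * (1 - complex_of_real p)"
        using q(2) by (metis of_real_1 of_real_diff of_real_mult power2_eq_square)
      have "w\<^sup>2 = 4 * (complex_of_real q * complex_of_real q) * e\<^sup>2"
        by (simp add: w_def power2_eq_square)
      then have w2: "w\<^sup>2 = 4 * (1 - p) * cnj u"
        by (simp add: cq u_def)
      have "z * w = - 2 * p\<^sup>2 * Re (e ^ 3) * e"
        using q(1) by (simp add: z_def w_def)
      also have "\<dots> = - p\<^sup>2 * ((e ^ 3 + cnj (e ^ 3)) * e)"
        unfolding complex_add_cnj by simp
      also have "(e ^ 3 + cnj (e ^ 3)) * e = (e\<^sup>2)\<^sup>2 + (e * cnj e) * (cnj e)\<^sup>2"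
        by (simp add: power2_eq_square power3_eq_cube algebra_simps)
      finally have zw: "z * w = - p * u - (cnj u)\<^sup>2"
        by (simp add: ee u_def power_mult_distrib power2_eq_square algebra_simps)
      have "(u, z, w) \<in> model \<rho>"
        by (rule model_intro) (use cu p z w2 zw in auto)
      moreover have "u \<noteq> 0"
        using cu p by auto
      moreover have "f (u, z, w) = e"
      proof -
        have "cmod w = 2 * q"
          using q(1) e by (simp add: w_def norm_mult)
        then have "sgn w = w /\<^sub>R (2 * q)"
          by (simp add: sgn_div_norm)
        then show ?thesis
          using q(1) by (simp add: f_def w_def scaleR_conv_of_real)
      qed
      ultimately show "e \<in> f ` model_nz \<rho>"
        by (force simp: model_nz_def)
    qed
  qed
qed

lemma model_nz_side:
  assumes "3 < \<rho>" "(u, z, w) \<in> model_nz \<rho>"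
  shows "z \<noteq> 0"
proof
  assume "z = 0"
  moreover have n: "(u, z, w) \<in> model \<rho>" "u \<noteq> 0" "\<rho> \<noteq> 3"
    using assms by (auto simp: model_nz_def)
  ultimately have "\<rho> = 1 + cmod u + (cmod u)\<^sup>2"
    using model_nonzero(4)[OF n] by simp
  moreover have "(cmod u)\<^sup>2 \<le> 1"
    using model_nonzero(3)[OF n] by (simp add: power_le_one)
  ultimately show False
    using model_nonzero(3)[OF n] assms by linarith
qed

text \<open>The sign \<open>s\<close> is weakened to \<open>0 \<le> s * z\<close>, so that the side
  is closed; \<open>z\<close> never vanishes here. Given \<open>u\<close> and the sign,
  \<open>z\<close> is a square root and \<open>w\<close> a quotient by \<open>z\<close>. The
  argument of \<open>w\<close> would not do, since \<open>w = 0\<close> where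
  \<open>u^3 = - 1\<close>.\<close>

lemma model_nz_circle_side:
  fixes s :: real
  assumes "3 < \<rho>" "\<bar>s\<bar> = 1"
  defines "K \<equiv> {x \<in> model_nz \<rho>. 0 \<le> s * fst (snd x)}"
  shows "compact K" "top_of_set K homeomorphic_space circle_space"
proof -
  have ss: "s * s = 1"
    using assms(2) by (metis abs_mult_self_eq mult_1)
  have "closed {x :: complex \<times> real \<times> complex. 0 \<le> s * fst (snd x)}"
    by (intro closed_Collect_le continuous_intros)
  moreover have "K = model_nz \<rho> \<inter> {x. 0 \<le> s * fst (snd x)}"
    by (auto simp: K_def)
  ultimately show K: "compact K"
    using compact_model_nz[of \<rho>] assms by (simp add: compact_Int_closed)
  define f :: "complex \<times> real \<times> complex \<Rightarrow> complex" where "f = (\<lambda>x. sgn (fst x))"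
  show "top_of_set K homeomorphic_space circle_space"
  proof (rule compact_homeomorphic_circle_space[of _ f])
    show "continuous_on K f"
      unfolding f_def by (intro continuous_intros) (auto simp: K_def model_nz_def)
    have polar: "u = complex_of_real (cmod u) * sgn u" "cmod (sgn u) = 1"
      and rad: "(1 - cmod u) * (\<rho> - 1 - cmod u - (cmod u)\<^sup>2) = cmod u ^ 3 * ((1 + Re (sgn u ^ 3)) / 2)"
      and E: "0 \<le> (1 + Re (sgn u ^ 3)) / 2"
      and z: "z = s * sqrt (\<rho> - 1 - cmod u - (cmod u)\<^sup>2)"
      if "(u, z, w) \<in> K" for u z and w :: complex
    proof -
      have n: "(u, z, w) \<in> model \<rho>" "u \<noteq> 0" "\<rho> \<noteq> 3"
        using that assms by (auto simp: model_nz_def K_def)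
      note n = n(2) model_nonzero[OF n]
      show us: "u = complex_of_real (cmod u) * sgn u"
        using n(1) by (simp add: sgn_div_norm scaleR_conv_of_real)
      show s1: "cmod (sgn u) = 1"
        using n(1) by (simp add: norm_sgn)
      have "\<bar>Re (sgn u ^ 3)\<bar> \<le> 1"
        by (metis abs_Re_le_cmod norm_power power_one s1)
      then show "0 \<le> (1 + Re (sgn u ^ 3)) / 2"
        by simp
      have "u ^ 3 = complex_of_real (cmod u ^ 3) * sgn u ^ 3"
        by (subst us) (simp add: power_mult_distrib)
      then have "Re (u ^ 3) = cmod u ^ 3 * Re (sgn u ^ 3)"
        by (metis Re_complex_of_real Im_complex_of_real diff_zero mult_zero_left times_complex.sel(1))
      with n(6) have "(1 - cmod u) * z\<^sup>2 = cmod u ^ 3 * ((1 + Re (sgn u ^ 3)) / 2)"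
        by (simp add: algebra_simps)
      moreover have zz: "z\<^sup>2 = \<rho> - 1 - cmod u - (cmod u)\<^sup>2"
        using n(5) by simp
      ultimately show "(1 - cmod u) * (\<rho> - 1 - cmod u - (cmod u)\<^sup>2) = cmod u ^ 3 * ((1 + Re (sgn u ^ 3)) / 2)"
        by simp
      have "(s * z)\<^sup>2 = (s * s) * z\<^sup>2"
        by (simp add: power2_eq_square)
      then have "sqrt ((s * z)\<^sup>2) = sqrt (\<rho> - 1 - cmod u - (cmod u)\<^sup>2)"
        unfolding ss zz by simp
      moreover have "sqrt ((s * z)\<^sup>2) = s * z"
        using that by (simp add: K_def)
      ultimately have "s * z = sqrt (\<rho> - 1 - cmod u - (cmod u)\<^sup>2)"
        by simp
      then show "z = s * sqrt (\<rho> - 1 - cmod u - (cmod u)\<^sup>2)"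
        using ss by (metis mult.assoc mult_1)
    qed
    show "inj_on f K"
    proof (rule inj_onI, clarify)
      fix u z and w :: complex and u' z' and w' :: complex
      assume x: "(u, z, w) \<in> K" and x': "(u', z', w') \<in> K"
        and "f (u, z, w) = f (u', z', w')"
      then have s: "sgn u = sgn u'"
        by (simp add: f_def)
      have m: "(u, z, w) \<in> model \<rho>" "u \<noteq> 0" "\<rho> \<noteq> 3" and m': "(u', z', w') \<in> model \<rho>" "u' \<noteq> 0" "\<rho> \<noteq> 3"
        using x x' assms by (auto simp: model_nz_def K_def)
      note n = model_nonzero[OF m] and n' = model_nonzero[OF m']
      have pos: "0 \<le> \<rho> - 1 - cmod u - (cmod u)\<^sup>2" "0 \<le> \<rho> - 1 - cmod u' - (cmod u')\<^sup>2"
        using n(4) n'(4) zero_le_power2[of z] zero_le_power2[of z'] by linarith+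
      have p: "cmod u = cmod u'"
        by (rule radius_unique[where E = "(1 + Re (sgn u ^ 3)) / 2" and \<rho> = \<rho>])
          (use rad[OF x] rad[OF x'] E[OF x] pos n(3) n'(3) s in auto)
      have u: "u = u'"
        using polar[OF x] polar[OF x'] s p by auto
      have z: "z = z'"
        using z[OF x] z[OF x'] p by simp
      have "z * w = z * w'"
        using n(8) n'(8) u z by simp
      moreover have "z \<noteq> 0"
        using model_nz_side[OF assms(1)] x by (auto simp: K_def)
      ultimately show "(u = u') \<and> (z, w) = (z', w')"
        using u z by simp
    qed
    show "f ` K = sphere 0 1"
    proof (intro equalityI subsetI)
      fix e assume "e \<in> f ` K"
      then show "e \<in> sphere 0 1"
        by (auto simp: f_def norm_sgn K_def model_nz_def)
    next
      fix e :: complex assume "e \<in> sphere 0 1"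
      then have e: "cmod e = 1" and ee: "e * cnj e = 1"
        by (auto simp: unit_cnj)
      have "\<bar>Re (e ^ 3)\<bar> \<le> 1"
        by (metis abs_Re_le_cmod norm_power power_one e)
      then have "0 \<le> (1 + Re (e ^ 3)) / 2" "1 < \<rho>"
        using assms by auto
      then obtain p where p: "0 < p" "p \<le> 1"
          "(1 - p) * (\<rho> - 1 - p - p\<^sup>2) = p ^ 3 * ((1 + Re (e ^ 3)) / 2)" "0 \<le> \<rho> - 1 - p - p\<^sup>2"
        by (rule radius_exists)
      have "p\<^sup>2 \<le> 1"
        using p by (simp add: power_le_one)
      then have pos: "\<rho> - 1 - p - p\<^sup>2 > 0"
        using p assms by linarith
      define u z where "u = p * e" and "z = s * sqrt (\<rho> - 1 - p - p\<^sup>2)"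
      \<comment> \<open>The third equation holds by this choice; what remains is to recover the
        formula for \<open>w^2\<close> from it by squaring.\<close>
      define w where "w = (- p * u - (cnj u)\<^sup>2) / z"
      have cu: "cmod u = p"
        using p e by (simp add: u_def norm_mult)
      have z0: "z \<noteq> 0"
        using pos ss by (auto simp: z_def)
      have z2: "z\<^sup>2 = \<rho> - 1 - p - p\<^sup>2"
      proof -
        have "z\<^sup>2 = (s * s) * (sqrt (\<rho> - 1 - p - p\<^sup>2))\<^sup>2"
          by (simp add: z_def power2_eq_square)
        then show ?thesis
          using pos unfolding ss by simp
      qed
      have zw: "z * w = - p * u - (cnj u)\<^sup>2"
        using z0 by (simp add: w_def)
      have "(- p * u - (cnj u)\<^sup>2)\<^sup>2 = complex_of_real (p ^ 4) * (e\<^sup>2 + 2 * (e * cnj e) * cnj e + cnj e ^ 4)"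
        by (simp add: u_def power2_eq_square power4_eq_xxxx algebra_simps)
      \<comment> \<open>A polynomial identity for every \<open>e\<close>, arranged so that
        \<open>e * cnj e = 1\<close> leaves only the last summand.\<close>
      also have "e\<^sup>2 + 2 * (e * cnj e) * cnj e + cnj e ^ 4 = 
          ((e * cnj e) * e ^ 2 - e ^ 3 * cnj e) + (1 - (e * cnj e)) * e\<^sup>2 + cnj e * (e ^ 3 + cnj (e ^ 3) + 2 * (e * cnj e))"
        by (simp add: power2_eq_square power3_eq_cube power4_eq_xxxx algebra_simps)
      also have "\<dots> = cnj e * (e ^ 3 + cnj (e ^ 3) + 2)"
        unfolding ee using ee by (simp add: power2_eq_square power3_eq_cube)
      also have "\<dots> = complex_of_real (4 * ((1 + Re (e ^ 3)) / 2)) * cnj e"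
        unfolding complex_add_cnj by simp
      also have "complex_of_real (p ^ 4) * (complex_of_real (4 * ((1 + Re (e ^ 3)) / 2)) * cnj e)
          = complex_of_real (4 * (p ^ 3 * ((1 + Re (e ^ 3)) / 2))) * cnj u"
        by (simp add: u_def power3_eq_cube power4_eq_xxxx)
      also have "\<dots> = complex_of_real (z\<^sup>2) * (4 * (1 - p) * cnj u)"
        unfolding p(3)[symmetric] z2[symmetric] by simp
      finally have "(z * w)\<^sup>2 = complex_of_real (z\<^sup>2) * (4 * (1 - p) * cnj u)"
        unfolding zw .
      then have "complex_of_real (z\<^sup>2) * w\<^sup>2 = complex_of_real (z\<^sup>2) * (4 * (1 - p) * cnj u)"
        by (simp add: power_mult_distrib)
      then have w2: "w\<^sup>2 = 4 * (1 - p) * cnj u"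
        using z0 by simp
      have "(u, z, w) \<in> model \<rho>"
        by (rule model_intro) (use cu p z2 w2 zw in auto)
      moreover have "u \<noteq> 0"
        using cu p by auto
      moreover have "s * z \<ge> 0"
        using ss pos by (simp add: z_def mult.assoc[symmetric])
      moreover have "f (u, z, w) = e"
        using p(1) cu by (simp add: f_def sgn_div_norm) (simp add: u_def scaleR_conv_of_real)
      ultimately show "e \<in> f ` K"
        by (force simp: model_nz_def K_def)
    qed
  qed (rule K)
qed

section \<open>Components of the model\<close>

definition in_circle_component :: "'a topology \<Rightarrow> 'a \<Rightarrow> bool" where
  "in_circle_component X x \<longleftrightarrow>
    (\<exists>C \<in> connected_components_of X. x \<in> C \<and> subtopology X C homeomorphic_space circle_space)"

lemma in_circle_component_decomposition:
  fixes S :: "'a::t2_space set" and m n :: nat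
  assumes S: "S = (\<Union>k<m + n. U k)" and disj: "disjoint_family_on U {..<m + n}"
    and circ: "\<And>k. k < m \<Longrightarrow> compact (U k) \<and> top_of_set (U k) homeomorphic_space circle_space"
    and pt: "\<And>k. m \<le> k \<Longrightarrow> k < m + n \<Longrightarrow> \<exists>a. U k = {a}"
    and k: "k < m" "x \<in> U k"
  shows "in_circle_component (top_of_set S) x"
proof -
  have "U k \<in> connected_components_of (top_of_set S)"
    using circles_and_points_decomposition(2)[where U = U, OF S disj circ pt] k(1) by blast
  moreover have "U k \<subseteq> S"
    using S k(1) by auto
  ultimately show ?thesis
    using circ[OF k(1)] k(2) by (auto simp: in_circle_component_def subtopology_subtopology inf.absorb2)
qed

lemma model_split:
  assumes "1 < \<rho>" "x \<in> model \<rho>" "fst x = 0"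
  obtains z where "x = (0, z, 0)" "z\<^sup>2 = \<rho> - 1 \<or> z\<^sup>2 = \<rho> - 3"
  using assms model_zero_iff[of \<rho> "fst (snd x)" "snd (snd x)"] by (cases x rule: prod_cases3) auto

lemma square_eq_iff_sqrt: "0 \<le> a \<Longrightarrow> z\<^sup>2 = a \<longleftrightarrow> z = sqrt a \<or> z = - sqrt a"
  by (metis power2_eq_iff real_sqrt_pow2)

text \<open>Since \<open>\<rho> - 3 < 0\<close>, only \<open>z^2 = \<rho> - 1\<close> has real
  roots, which leaves two isolated points besides the circle.\<close>

lemma model_topology_below_3:
  assumes "1 < \<rho>" "\<rho> < 3"
  shows "top_of_set (model \<rho>) homeomorphic_space circles_and_points 1 2"
    and "\<And>x. x \<in> model \<rho> \<Longrightarrow> fst x \<noteq> 0 \<Longrightarrow> in_circle_component (top_of_set (model \<rho>)) x"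
    and "\<And>x. x \<in> model \<rho> \<Longrightarrow> fst x = 0 \<Longrightarrow> openin (top_of_set (model \<rho>)) {x}"
proof -
  define a b :: "complex \<times> real \<times> complex" where
    "a = (0, sqrt (\<rho> - 1), 0)" and "b = (0, - sqrt (\<rho> - 1), 0)"
  define U where "U k = (if k = 0 then model_nz \<rho> else if k = 1 then {a} else {b})" for k :: nat
  have ivl: "{..<1 + 2 :: nat} = {0, 1, 2}"
    by auto
  have ab: "x = a \<or> x = b" if x: "x \<in> model \<rho>" "fst x = 0" for x
  proof -
    obtain z where z: "x = (0, z, 0)" "z\<^sup>2 = \<rho> - 1 \<or> z\<^sup>2 = \<rho> - 3"
      using model_split[OF assms(1) x] .
    then have "z\<^sup>2 = \<rho> - 1"
      using assms(2) zero_le_power2[of z] by linarith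
    with z(1) assms(1) show ?thesis
      by (simp add: square_eq_iff_sqrt a_def b_def)
  qed
  have mem: "a \<in> model \<rho>" "b \<in> model \<rho>"
    using assms by (simp_all add: a_def b_def model_zero_iff)
  have S: "model \<rho> = (\<Union>k<1 + 2. U k)"
    unfolding ivl using ab mem by (auto simp: U_def model_nz_def)
  have "a \<noteq> b"
    using assms by (simp add: a_def b_def)
  then have disj: "disjoint_family_on U {..<1 + 2}"
    unfolding ivl by (auto simp: disjoint_family_on_def U_def model_nz_def a_def b_def)
  have circ: "compact (U k) \<and> top_of_set (U k) homeomorphic_space circle_space" if "k < 1" for k
    using that assms by (simp add: U_def compact_model_nz model_nz_circle)
  have pt: "\<exists>a. U k = {a}" if "1 \<le> k" "k < 1 + 2" for k
    using that unfolding U_def by (metis not_one_le_zero)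
  note dec = circles_and_points_decomposition[where U = U, OF S disj circ pt]
  show "top_of_set (model \<rho>) homeomorphic_space circles_and_points 1 2"
    by (rule dec(1))
  show "in_circle_component (top_of_set (model \<rho>)) x" if "x \<in> model \<rho>" "fst x \<noteq> 0" for x
    by (rule in_circle_component_decomposition[where U = U, OF S disj circ pt, of 0])
      (use that in \<open>auto simp: U_def model_nz_def\<close>)
  have "openin (top_of_set (model \<rho>)) {a}" "openin (top_of_set (model \<rho>)) {b}"
    using dec(3)[of 1] dec(3)[of 2] by (simp_all add: U_def)
  then show "openin (top_of_set (model \<rho>)) {x}" if "x \<in> model \<rho>" "fst x = 0" for x
    using ab[OF that] by auto
qed

text \<open>Both equations for \<open>z^2\<close> now have two roots, and
  \<open>sqrt (\<rho> - 1) > sqrt (\<rho> - 3) > 0\<close> keeps the four apart. The nonzero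
  solutions split by the sign of \<open>z\<close>.\<close>

lemma model_topology_above_3:
  assumes "3 < \<rho>"
  shows "top_of_set (model \<rho>) homeomorphic_space circles_and_points 2 4"
    and "\<And>x. x \<in> model \<rho> \<Longrightarrow> fst x \<noteq> 0 \<Longrightarrow> in_circle_component (top_of_set (model \<rho>)) x"
    and "\<And>x. x \<in> model \<rho> \<Longrightarrow> fst x = 0 \<Longrightarrow> openin (top_of_set (model \<rho>)) {x}"
proof -
  define K where "K s = {x \<in> model_nz \<rho>. 0 \<le> s * fst (snd x)}" for s :: real
  define a b c d :: "complex \<times> real \<times> complex" where
    "a = (0, sqrt (\<rho> - 1), 0)" and "b = (0, - sqrt (\<rho> - 1), 0)" and
    "c = (0, sqrt (\<rho> - 3), 0)" and "d = (0, - sqrt (\<rho> - 3), 0)"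
  define U where "U k = (if k = 0 then K 1 else if k = 1 then K (- 1) else if k = 2 then {a}
    else if k = 3 then {b} else if k = 4 then {c} else {d})" for k :: nat
  have ivl: "{..<2 + 4 :: nat} = {0, 1, 2, 3, 4, 5}"
    by auto
  have ab: "x = a \<or> x = b \<or> x = c \<or> x = d" if x: "x \<in> model \<rho>" "fst x = 0" for x
  proof -
    have "1 < \<rho>"
      using assms by simp
    then obtain z where z: "x = (0, z, 0)" "z\<^sup>2 = \<rho> - 1 \<or> z\<^sup>2 = \<rho> - 3"
      using model_split x by blast
    with assms show ?thesis
      by (auto simp: square_eq_iff_sqrt a_def b_def c_def d_def)
  qed
  have mem: "a \<in> model \<rho>" "b \<in> model \<rho>" "c \<in> model \<rho>" "d \<in> model \<rho>"
    using assms by (simp_all add: a_def b_def c_def d_def model_zero_iff)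
  have K: "model_nz \<rho> = K 1 \<union> K (- 1)"
    by (auto simp: K_def)
  have K0: "x \<in> model \<rho>" "fst x \<noteq> 0" if "x \<in> K s" for x s
    using that by (auto simp: K_def model_nz_def)
  have S: "model \<rho> = (\<Union>k<2 + 4. U k)"
  proof -
    have "model \<rho> = model_nz \<rho> \<union> {a, b, c, d}"
      using ab mem by (auto simp: model_nz_def)
    then show ?thesis
      unfolding ivl K by (simp add: U_def Un_assoc insert_commute Un_commute)
  qed
  have KK: "K 1 \<inter> K (- 1) = {}"
  proof -
    have "False" if "x \<in> K 1" "x \<in> K (- 1)" for x
    proof -
      have "x \<in> model_nz \<rho>"
        using that(1) by (simp add: K_def)
      then have "(fst x, fst (snd x), snd (snd x)) \<in> model_nz \<rho>"
        by (simp only: prod.collapse)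
      then have "fst (snd x) \<noteq> 0"
        by (rule model_nz_side[OF assms])
      with that show False
        by (auto simp: K_def)
    qed
    then show ?thesis
      by blast
  qed
  have lt: "sqrt (\<rho> - 3) < sqrt (\<rho> - 1)" "0 < sqrt (\<rho> - 3)"
    using assms by auto
  then have dist: "a \<noteq> b" "a \<noteq> c" "a \<noteq> d" "b \<noteq> c" "b \<noteq> d" "c \<noteq> d"
    unfolding a_def b_def c_def d_def prod.inject by linarith+
  have zero: "fst a = 0" "fst b = 0" "fst c = 0" "fst d = 0"
    by (auto simp: a_def b_def c_def d_def)
  have notK: "a \<notin> K s" "b \<notin> K s" "c \<notin> K s" "d \<notin> K s" for s
    using K0(2) zero by metis+
  have disj: "disjoint_family_on U {..<2 + 4}"
    unfolding ivl using notK KK dist by (simp add: disjoint_family_on_def U_def Int_commute)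
  have circ: "compact (U k) \<and> top_of_set (U k) homeomorphic_space circle_space" if "k < 2" for k
  proof -
    have "U k = K 1 \<or> U k = K (- 1)"
      using that by (auto simp: U_def)
    then show ?thesis
      using model_nz_circle_side[OF assms, of 1] model_nz_circle_side[OF assms, of "- 1"]
      by (auto simp: K_def)
  qed
  have pt: "\<exists>a. U k = {a}" if "2 \<le> k" "k < 2 + 4" for k
  proof -
    have "U k = {if k = 2 then a else if k = 3 then b else if k = 4 then c else d}"
      using that by (auto simp: U_def)
    then show ?thesis
      by blast
  qed
  note dec = circles_and_points_decomposition[where U = U, OF S disj circ pt]
  show "top_of_set (model \<rho>) homeomorphic_space circles_and_points 2 4"
    by (rule dec(1))
  show "in_circle_component (top_of_set (model \<rho>)) x" if "x \<in> model \<rho>" "fst x \<noteq> 0" for x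
  proof -
    have "x \<in> U 0 \<or> x \<in> U 1"
      using that K by (auto simp: U_def model_nz_def)
    then show ?thesis
      using in_circle_component_decomposition[where U = U, OF S disj circ pt, of 0 x]
        in_circle_component_decomposition[where U = U, OF S disj circ pt, of 1 x] by auto
  qed
  have "openin (top_of_set (model \<rho>)) {a}" "openin (top_of_set (model \<rho>)) {b}"
    "openin (top_of_set (model \<rho>)) {c}" "openin (top_of_set (model \<rho>)) {d}"
    using dec(3)[of 2] dec(3)[of 3] dec(3)[of 4] dec(3)[of 5] by (simp_all add: U_def)
  then show "openin (top_of_set (model \<rho>)) {x}" if "x \<in> model \<rho>" "fst x = 0" for x
    using ab[OF that] by auto
qed

section \<open>Hexagons as pairs of triangles\<close>

lemma exhaust_6:
  fixes x :: 6
  shows "x = 0 \<or> x = 1 \<or> x = 2 \<or> x = 3 \<or> x = 4 \<or> x = 5"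
proof (induct x)
  case (of_int z)
  then have "0 \<le> z" "z < 6" by simp_all
  then have "z = 0 \<or> z = 1 \<or> z = 2 \<or> z = 3 \<or> z = 4 \<or> z = 5" by arith
  then show ?case by auto
qed

lemma forall_6: "(\<forall>i::6. P i) \<longleftrightarrow> P 0 \<and> P 1 \<and> P 2 \<and> P 3 \<and> P 4 \<and> P 5"
  by (metis exhaust_6)

abbreviation sqnorm :: "'a::real_inner \<Rightarrow> real" where
  "sqnorm x \<equiv> x \<bullet> x"

lemma sqnorm_commute: "sqnorm (x - y) = sqnorm (y - x)"
  by (metis inner_minus_left inner_minus_right minus_diff_eq minus_minus)

lemma sqnorm_scaled_diff: "sqnorm ((c + r *\<^sub>R x) - (c + r *\<^sub>R y)) = r\<^sup>2 * sqnorm (x - y)"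
proof -
  have "(c + r *\<^sub>R x) - (c + r *\<^sub>R y) = r *\<^sub>R (x - y)"
    by (simp add: algebra_simps)
  then show ?thesis
    by (simp add: power2_eq_square)
qed

text \<open>The law of cosines: with unit sides, prescribing the angle means prescribing the short
  diagonal. All conditions become polynomial.\<close>

lemma hexagons_iff:
  assumes "0 \<le> \<theta>" "\<theta> \<le> pi"
  shows "P \<in> hexagons \<theta> \<longleftrightarrow> (\<forall>i. sqnorm (P $ i - P $ (i + 1)) = 1 \<and>
    sqnorm (P $ (i - 1) - P $ (i + 1)) = 2 - 2 * cos \<theta>)"
proof -
  have dist: "dist x y = 1 \<longleftrightarrow> sqnorm (x - y) = 1" for x y :: "real^3"
    by (simp add: dist_norm norm_eq_1)
  have angle: "vertex_angle A B C = \<theta> \<longleftrightarrow> sqnorm (A - C) = 2 - 2 * cos \<theta>"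
    if "dist A B = 1" "dist B C = 1" for A B C :: "real^3"
  proof -
    have n: "norm (A - B) = 1" "norm (C - B) = 1"
      using that by (simp_all add: dist_norm norm_minus_commute)
    then have "\<bar>(A - B) \<bullet> (C - B)\<bar> \<le> 1"
      using Cauchy_Schwarz_ineq2[of "A - B" "C - B"] by simp
    then have "vertex_angle A B C = \<theta> \<longleftrightarrow> (A - B) \<bullet> (C - B) = cos \<theta>"
      using assms n by (auto simp: vertex_angle_def cos_arccos_abs arccos_cos)
    moreover have "sqnorm (A - C) = sqnorm (A - B) + sqnorm (C - B) - 2 * ((A - B) \<bullet> (C - B))"
      by (simp add: inner_diff_left inner_diff_right inner_commute algebra_simps)
    ultimately show ?thesis
      using n by (auto simp: norm_eq_1)
  qed
  have "(\<forall>i. dist (P $ i) (P $ (i + 1)) = 1 \<and> vertex_angle (P $ (i - 1)) (P $ i) (P $ (i + 1)) = \<theta>) \<longleftrightarrow>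
    (\<forall>i. dist (P $ i) (P $ (i + 1)) = 1 \<and> sqnorm (P $ (i - 1) - P $ (i + 1)) = 2 - 2 * cos \<theta>)"
  proof -
    have "dist (P $ (i - 1)) (P $ i) = 1" if "\<forall>i. dist (P $ i) (P $ (i + 1)) = 1" for i
      using that[THEN spec, of "i - 1"] by simp
    then show ?thesis
      using angle by blast
  qed
  then show ?thesis
    unfolding hexagons_def dist by blast
qed

text \<open>Unit sides and Cauchy-Schwarz put the argument of \<open>arccos\<close> into
  \<open>[- 1, 1]\<close>, where its values lie in \<open>[0, pi]\<close>.\<close>

lemma hexagons_empty:
  assumes "\<theta> < 0 \<or> \<theta> > pi"
  shows "hexagons \<theta> = {}"
proof -
  have False if "P \<in> hexagons \<theta>" for P
  proof -
    have d: "dist (P $ i) (P $ (i + 1)) = 1" "vertex_angle (P $ (i - 1)) (P $ i) (P $ (i + 1)) = \<theta>" for i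
      using that by (auto simp: hexagons_def)
    have n: "norm (P $ 0 - P $ 1) = 1" "norm (P $ 2 - P $ 1) = 1"
      using d(1)[of 0] d(1)[of 1] by (simp_all add: dist_norm norm_minus_commute)
    then have "\<bar>(P $ 0 - P $ 1) \<bullet> (P $ 2 - P $ 1)\<bar> \<le> 1"
      using Cauchy_Schwarz_ineq2[of "P $ 0 - P $ 1" "P $ 2 - P $ 1"] by simp
    moreover have "\<theta> = arccos ((P $ 0 - P $ 1) \<bullet> (P $ 2 - P $ 1))"
      using d(2)[of 1] n by (simp add: vertex_angle_def)
    ultimately have "0 \<le> \<theta>" "\<theta> \<le> pi"
      using arccos_bounded by (auto simp: abs_le_iff arccos_lbound arccos_ubound)
    with assms show False
      by linarith
  qed
  then show ?thesis
    by blast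
qed

section \<open>Edge equations for a pair of triangles\<close>

definition hex6 :: "'a \<Rightarrow> 'a \<Rightarrow> 'a \<Rightarrow> 'a \<Rightarrow> 'a \<Rightarrow> 'a \<Rightarrow> 'a^6" where
  "hex6 a b c d e f = (\<chi> i. if i = 0 then a else if i = 1 then b else if i = 2 then c
    else if i = 3 then d else if i = 4 then e else f)"

lemma hex6_nth [simp]:
  "hex6 a b c d e f $ 0 = a" "hex6 a b c d e f $ 1 = b" "hex6 a b c d e f $ 2 = c"
  "hex6 a b c d e f $ 3 = d" "hex6 a b c d e f $ 4 = e" "hex6 a b c d e f $ 5 = f"
  by (simp_all add: hex6_def)

text \<open>
  The even vertices form an equilateral triangle with centre \<open>c\<close> and the odd vertices one with
  centre \<open>c + r t\<close>, both of circumradius \<open>r\<close>; vertex \<open>3\<close> of the second triangle is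
  opposite to vertex \<open>0\<close> of the first.
\<close>

definition two_triangles ::
  "'a::real_vector \<Rightarrow> real \<Rightarrow> 'a \<Rightarrow> 'a \<Rightarrow> 'a \<Rightarrow> 'a \<Rightarrow> 'a \<Rightarrow> 'a^6" where
  "two_triangles c r e1 e2 U V t = (let s = sqrt 3 / 2 in hex6
      (c + r *\<^sub>R e1)
      (c + r *\<^sub>R (t - (1 / 2) *\<^sub>R U - s *\<^sub>R V))
      (c + r *\<^sub>R (- (1 / 2) *\<^sub>R e1 + s *\<^sub>R e2))
      (c + r *\<^sub>R (t + U))
      (c + r *\<^sub>R (- (1 / 2) *\<^sub>R e1 - s *\<^sub>R e2))
      (c + r *\<^sub>R (t - (1 / 2) *\<^sub>R U + s *\<^sub>R V)))"

definition orthonormal2 :: "'a::real_inner \<Rightarrow> 'a \<Rightarrow> bool" where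
  "orthonormal2 a b \<longleftrightarrow> sqnorm a = 1 \<and> sqnorm b = 1 \<and> a \<bullet> b = 0"

text \<open>The three squared sides are linear in \<open>|a|^2\<close>, \<open>|b|^2\<close> and
  \<open>s * (a \<bullet> b)\<close> once \<open>s * s = 3 / 4\<close>, and this linear system has a
  unique solution.\<close>

lemma triangle_sides:
  fixes a b :: "'a::real_inner"
  defines "s \<equiv> sqrt 3 / 2"
  shows "(sqnorm (a - (- (1 / 2) *\<^sub>R a + s *\<^sub>R b)) = 3 \<and>
      sqnorm ((- (1 / 2) *\<^sub>R a + s *\<^sub>R b) - (- (1 / 2) *\<^sub>R a - s *\<^sub>R b)) = 3 \<and>
      sqnorm ((- (1 / 2) *\<^sub>R a - s *\<^sub>R b) - a) = 3) \<longleftrightarrow> orthonormal2 a b"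
proof -
  have s: "s * s = 3 / 4" "s \<noteq> 0"
    by (auto simp: s_def)
  have 1: "sqnorm (a - (- (1 / 2) *\<^sub>R a + s *\<^sub>R b)) = 9 / 4 * sqnorm a - 3 * (s * (a \<bullet> b)) + (s * s) * sqnorm b"
    and 2: "sqnorm ((- (1 / 2) *\<^sub>R a - s *\<^sub>R b) - a) = 9 / 4 * sqnorm a + 3 * (s * (a \<bullet> b)) + (s * s) * sqnorm b"
    and 3: "sqnorm ((- (1 / 2) *\<^sub>R a + s *\<^sub>R b) - (- (1 / 2) *\<^sub>R a - s *\<^sub>R b)) = 4 * (s * s) * sqnorm b"
    by (simp_all add: inner_diff_left inner_diff_right inner_add_left inner_add_right inner_commute algebra_simps)
  have "a \<bullet> b = 0 \<longleftrightarrow> s * (a \<bullet> b) = 0"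
    using s by simp
  then show ?thesis
    unfolding 1 2 3 s(1) orthonormal2_def by (intro iffI; elim conjE; intro conjI; linarith)
qed

text \<open>Six linear equations for the six products on the right, with
  \<open>t \<bullet> e1\<close>, \<open>t \<bullet> e2\<close> and \<open>|t|^2\<close> as data.
  They come in three pairs exchanged by \<open>s \<rightarrow> - s\<close>: the differences
  determine the three products carrying a factor \<open>s\<close>, the sums the other three.\<close>

lemma six_distances:
  fixes e1 e2 U V t :: "'a::real_inner" and \<rho> :: real
  assumes "orthonormal2 e1 e2" "orthonormal2 U V"
  defines "s \<equiv> sqrt 3 / 2" and "k \<equiv> 2 + sqnorm t - \<rho>"
  defines "a1 \<equiv> - (1 / 2) *\<^sub>R e1 + s *\<^sub>R e2" and "a2 \<equiv> - (1 / 2) *\<^sub>R e1 - s *\<^sub>R e2"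
    and "b1 \<equiv> t - (1 / 2) *\<^sub>R U + s *\<^sub>R V" and "b2 \<equiv> t - (1 / 2) *\<^sub>R U - s *\<^sub>R V"
  shows "(sqnorm (e1 - b1) = \<rho> \<and> sqnorm (e1 - b2) = \<rho> \<and> sqnorm (a1 - (t + U)) = \<rho> \<and>
      sqnorm (a1 - b2) = \<rho> \<and> sqnorm (a2 - (t + U)) = \<rho> \<and> sqnorm (a2 - b1) = \<rho>) \<longleftrightarrow>
    (e1 \<bullet> U = t \<bullet> e1 - k \<and> e2 \<bullet> U = - (t \<bullet> e2) \<and> e1 \<bullet> V = - (t \<bullet> e2) \<and>
      e2 \<bullet> V = - (t \<bullet> e1) - k \<and> t \<bullet> U = - (t \<bullet> e1) \<and> t \<bullet> V = - (t \<bullet> e2))"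
    (is "?L \<longleftrightarrow> ?R")
proof -
  have s: "s * s = 3 / 4" "s \<noteq> 0"
    by (auto simp: s_def)
  have o: "e1 \<bullet> e1 = 1" "e2 \<bullet> e2 = 1" "e1 \<bullet> e2 = 0" "U \<bullet> U = 1" "V \<bullet> V = 1" "U \<bullet> V = 0"
      "e2 \<bullet> e1 = 0" "V \<bullet> U = 0"
    using assms(1,2) by (auto simp: orthonormal2_def inner_commute)
  have comm: "U \<bullet> e1 = e1 \<bullet> U" "U \<bullet> e2 = e2 \<bullet> U" "V \<bullet> e1 = e1 \<bullet> V" "V \<bullet> e2 = e2 \<bullet> V"
      "e1 \<bullet> t = t \<bullet> e1" "e2 \<bullet> t = t \<bullet> e2" "U \<bullet> t = t \<bullet> U" "V \<bullet> t = t \<bullet> V"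
    by (simp_all add: inner_commute)
  note ex = inner_diff_left inner_diff_right inner_add_left inner_add_right inner_minus_left
    inner_minus_right inner_scaleR_left inner_scaleR_right o comm
  have b1: "sqnorm (e1 - b1) = 5 / 4 + (s * s) + sqnorm t - 2 * (t \<bullet> e1) + e1 \<bullet> U - 2 * (s * (e1 \<bullet> V)) - t \<bullet> U + 2 * (s * (t \<bullet> V))"
    and b2: "sqnorm (e1 - b2) = 5 / 4 + (s * s) + sqnorm t - 2 * (t \<bullet> e1) + e1 \<bullet> U + 2 * (s * (e1 \<bullet> V)) - t \<bullet> U - 2 * (s * (t \<bullet> V))"
    and a1: "sqnorm (a1 - (t + U)) = 5 / 4 + (s * s) + sqnorm t + 2 * (t \<bullet> U) + t \<bullet> e1 + e1 \<bullet> U - 2 * (s * (t \<bullet> e2)) - 2 * (s * (e2 \<bullet> U))"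
    and a2: "sqnorm (a2 - (t + U)) = 5 / 4 + (s * s) + sqnorm t + 2 * (t \<bullet> U) + t \<bullet> e1 + e1 \<bullet> U + 2 * (s * (t \<bullet> e2)) + 2 * (s * (e2 \<bullet> U))"
    and ab1: "sqnorm (a1 - b2) = 1 / 2 + 2 * (s * s) + sqnorm t + t \<bullet> e1 - (e1 \<bullet> U) / 2 - s * (e1 \<bullet> V) - 2 * (s * (t \<bullet> e2))
        + s * (e2 \<bullet> U) + 2 * (s * s) * (e2 \<bullet> V) - t \<bullet> U - 2 * (s * (t \<bullet> V))"
    and ab2: "sqnorm (a2 - b1) = 1 / 2 + 2 * (s * s) + sqnorm t + t \<bullet> e1 - (e1 \<bullet> U) / 2 + s * (e1 \<bullet> V) + 2 * (s * (t \<bullet> e2))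
        - s * (e2 \<bullet> U) + 2 * (s * s) * (e2 \<bullet> V) - t \<bullet> U + 2 * (s * (t \<bullet> V))"
    unfolding a1_def a2_def b1_def b2_def ex by (simp_all add: algebra_simps)
  show ?thesis
  proof
    assume ?L
    then have "e1 \<bullet> U = t \<bullet> e1 - k \<and> s * (e2 \<bullet> U) = s * - (t \<bullet> e2) \<and> s * (e1 \<bullet> V) = s * - (t \<bullet> e2) \<and>
      e2 \<bullet> V = - (t \<bullet> e1) - k \<and> t \<bullet> U = - (t \<bullet> e1) \<and> s * (t \<bullet> V) = s * - (t \<bullet> e2)"
      unfolding a1 a2 b1 b2 ab1 ab2 s(1) k_def by simp
    then show ?R
      using s(2) by (metis mult_left_cancel)
  next
    assume ?R
    then have "s * (e2 \<bullet> U) = - (s * (t \<bullet> e2)) \<and> s * (e1 \<bullet> V) = - (s * (t \<bullet> e2)) \<and> s * (t \<bullet> V) = - (s * (t \<bullet> e2))"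
      by simp
    with \<open>?R\<close> show ?L
      unfolding a1 a2 b1 b2 ab1 ab2 s(1) k_def by (simp add: field_simps)
  qed
qed

lemma two_triangles_nth:
  fixes c :: "'a::real_vector"
  shows "two_triangles c r e1 e2 U V t $ 0 = c + r *\<^sub>R e1"
    "two_triangles c r e1 e2 U V t $ 1 = c + r *\<^sub>R (t - (1 / 2) *\<^sub>R U - (sqrt 3 / 2) *\<^sub>R V)"
    "two_triangles c r e1 e2 U V t $ 2 = c + r *\<^sub>R (- (1 / 2) *\<^sub>R e1 + (sqrt 3 / 2) *\<^sub>R e2)"
    "two_triangles c r e1 e2 U V t $ 3 = c + r *\<^sub>R (t + U)"
    "two_triangles c r e1 e2 U V t $ 4 = c + r *\<^sub>R (- (1 / 2) *\<^sub>R e1 - (sqrt 3 / 2) *\<^sub>R e2)"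
    "two_triangles c r e1 e2 U V t $ 5 = c + r *\<^sub>R (t - (1 / 2) *\<^sub>R U + (sqrt 3 / 2) *\<^sub>R V)"
  by (simp_all add: two_triangles_def Let_def)

text \<open>Short diagonals join vertices of the same triangle, edges join different triangles.
  After division by \<open>r\<close> the former have squared length 3, the latter
  \<open>1 / r^2\<close>, so \<open>triangle_sides\<close> and \<open>six_distances\<close> cover
  all twelve conditions.\<close>

lemma two_triangles_in_hexagons_iff:
  fixes c e1 e2 U V t :: "real^3"
  assumes "0 \<le> \<theta>" "\<theta> \<le> pi" "0 < r" "3 * r\<^sup>2 = 2 - 2 * cos \<theta>"
  defines "k \<equiv> 2 + sqnorm t - 1 / r\<^sup>2"
  shows "two_triangles c r e1 e2 U V t \<in> hexagons \<theta> \<longleftrightarrow> orthonormal2 e1 e2 \<and> orthonormal2 U V \<and>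
    e1 \<bullet> U = t \<bullet> e1 - k \<and> e2 \<bullet> U = - (t \<bullet> e2) \<and> e1 \<bullet> V = - (t \<bullet> e2) \<and>
      e2 \<bullet> V = - (t \<bullet> e1) - k \<and> t \<bullet> U = - (t \<bullet> e1) \<and> t \<bullet> V = - (t \<bullet> e2)"
proof -
  define s where "s = sqrt 3 / 2"
  define a1 a2 b1 b2 u1 u2 where "a1 = - (1 / 2) *\<^sub>R e1 + s *\<^sub>R e2" and "a2 = - (1 / 2) *\<^sub>R e1 - s *\<^sub>R e2"
    and "b1 = t - (1 / 2) *\<^sub>R U + s *\<^sub>R V" and "b2 = t - (1 / 2) *\<^sub>R U - s *\<^sub>R V"
    and "u1 = - (1 / 2) *\<^sub>R U + s *\<^sub>R V" and "u2 = - (1 / 2) *\<^sub>R U - s *\<^sub>R V"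
  note defs = a1_def a2_def b1_def b2_def u1_def u2_def
  have edge: "sqnorm ((c + r *\<^sub>R x) - (c + r *\<^sub>R y)) = 1 \<longleftrightarrow> sqnorm (x - y) = 1 / r\<^sup>2" for x y :: "real^3"
    unfolding sqnorm_scaled_diff using assms(3) by (auto simp: field_simps)
  have diag: "sqnorm ((c + r *\<^sub>R x) - (c + r *\<^sub>R y)) = 3 * r\<^sup>2 \<longleftrightarrow> sqnorm (x - y) = 3" for x y :: "real^3"
    unfolding sqnorm_scaled_diff using assms(3) by (auto simp: field_simps)
  have u: "b1 - b2 = u1 - u2" "b2 - (t + U) = u2 - U" "t + U - b1 = U - u1"
    by (simp_all add: defs algebra_simps)
  have ix: "(0::6) - 1 = 5" "(1::6) - 1 = 0" "(2::6) - 1 = 1" "(3::6) - 1 = 2" "(4::6) - 1 = 3" "(5::6) - 1 = 4"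
     "(0::6) + 1 = 1" "(1::6) + 1 = 2" "(2::6) + 1 = 3" "(3::6) + 1 = 4" "(4::6) + 1 = 5" "(5::6) + 1 = 0"
    by simp_all
  have "two_triangles c r e1 e2 U V t \<in> hexagons \<theta> \<longleftrightarrow>
    (sqnorm (e1 - a1) = 3 \<and> sqnorm (a1 - a2) = 3 \<and> sqnorm (a2 - e1) = 3) \<and>
    (sqnorm (U - u1) = 3 \<and> sqnorm (u1 - u2) = 3 \<and> sqnorm (u2 - U) = 3) \<and>
    (sqnorm (e1 - b1) = 1 / r\<^sup>2 \<and> sqnorm (e1 - b2) = 1 / r\<^sup>2 \<and> sqnorm (a1 - (t + U)) = 1 / r\<^sup>2 \<and>
      sqnorm (a1 - b2) = 1 / r\<^sup>2 \<and> sqnorm (a2 - (t + U)) = 1 / r\<^sup>2 \<and> sqnorm (a2 - b1) = 1 / r\<^sup>2)"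
    unfolding hexagons_iff[OF assms(1,2)] forall_6 ix two_triangles_nth s_def[symmetric] defs(1-4)[symmetric]
      assms(4)[symmetric] edge diag u sqnorm_commute[of b1 e1] sqnorm_commute[of b2 a1] sqnorm_commute[of "t + U" a2] by blast
  also have "\<dots> \<longleftrightarrow> orthonormal2 e1 e2 \<and> orthonormal2 U V \<and>
    (sqnorm (e1 - b1) = 1 / r\<^sup>2 \<and> sqnorm (e1 - b2) = 1 / r\<^sup>2 \<and> sqnorm (a1 - (t + U)) = 1 / r\<^sup>2 \<and>
      sqnorm (a1 - b2) = 1 / r\<^sup>2 \<and> sqnorm (a2 - (t + U)) = 1 / r\<^sup>2 \<and> sqnorm (a2 - b1) = 1 / r\<^sup>2)"
    unfolding defs(1,2,5,6) s_def triangle_sides ..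
  also have "\<dots> \<longleftrightarrow> orthonormal2 e1 e2 \<and> orthonormal2 U V \<and>
    e1 \<bullet> U = t \<bullet> e1 - k \<and> e2 \<bullet> U = - (t \<bullet> e2) \<and> e1 \<bullet> V = - (t \<bullet> e2) \<and>
      e2 \<bullet> V = - (t \<bullet> e1) - k \<and> t \<bullet> U = - (t \<bullet> e1) \<and> t \<bullet> V = - (t \<bullet> e2)"
    unfolding k_def defs(1-4) s_def using six_distances[of e1 e2 U V t "1 / r\<^sup>2"] by blast
  finally show ?thesis .
qed

definition model_t :: "complex \<times> real \<times> complex \<Rightarrow> real^3" where
  "model_t = (\<lambda>(u, z, w). vector [Re u, Im u, z])"

definition model_U :: "real \<Rightarrow> complex \<times> real \<times> complex \<Rightarrow> real^3" where
  "model_U \<rho> = (\<lambda>(u, z, w). vector [Re u - kappa \<rho> u z, - Im u, Re w])"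

definition model_V :: "real \<Rightarrow> complex \<times> real \<times> complex \<Rightarrow> real^3" where
  "model_V \<rho> = (\<lambda>(u, z, w). vector [- Im u, - Re u - kappa \<rho> u z, Im w])"

lemma inner_vector_3: "vector [a, b, c] \<bullet> (vector [x, y, z] :: real^3) = a * x + b * y + c * z"
  by (simp add: inner_vec_def sum_3)

text \<open>The real and imaginary parts of \<open>w^2 = 4 * kappa * cnj u\<close> are
  \<open>|U|^2 = |V|^2\<close> and, up to a factor, \<open>U \<bullet> V = 0\<close>. The remaining
  normalisation \<open>|U|^2 + |V|^2 = 2\<close> becomes \<open>|u| + |kappa| = 1\<close>.\<close>

lemma model_iff_vectors:
  "x \<in> model \<rho> \<longleftrightarrow> orthonormal2 (model_U \<rho> x) (model_V \<rho> x) \<and>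
    model_t x \<bullet> model_U \<rho> x = - Re (fst x) \<and> model_t x \<bullet> model_V \<rho> x = - Im (fst x)"
proof -
  obtain u z and w :: complex where x: "x = (u, z, w)"
    by (cases x rule: prod_cases3)
  define k a b c d where "k = kappa \<rho> u z" and "a = Re u" and "b = Im u" and "c = Re w" and "d = Im w"
  note ab = a_def[symmetric] b_def[symmetric] c_def[symmetric] d_def[symmetric]
  have R: "(orthonormal2 (model_U \<rho> x) (model_V \<rho> x) \<and>
    model_t x \<bullet> model_U \<rho> x = - Re (fst x) \<and> model_t x \<bullet> model_V \<rho> x = - Im (fst x)) \<longleftrightarrow>
    ((a - k) * (a - k) + b * b + c * c = 1 \<and> b * b + (a + k) * (a + k) + d * d = 1 \<and>
      2 * k * b + c * d = 0) \<and>
    a * (a - k) - b * b + z * c = - a \<and> - 2 * a * b - b * k + z * d = - b"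
    unfolding x model_t_def model_U_def model_V_def orthonormal2_def prod.case inner_vector_3 fst_conv
      k_def[symmetric] ab by (simp add: algebra_simps)
  have w2: "w\<^sup>2 = 4 * k * cnj u \<longleftrightarrow> c * c - d * d = 4 * k * a \<and> 2 * c * d = - 4 * k * b"
    by (simp add: complex_eq_iff power2_eq_square ab)
  have zw: "z * w = (k - 1) * u - (cnj u)\<^sup>2 \<longleftrightarrow>
      z * c = (k - 1) * a - (a * a - b * b) \<and> z * d = (k - 1) * b + 2 * (a * b)"
    by (simp add: complex_eq_iff power2_eq_square ab)
  \<comment> \<open>The first equation gives \<open>|w|^2 = 4 * |k| * |u|\<close>, which completes
    the right side to \<open>2 * (|u| + |k|)^2\<close>.\<close>
  have norms: "cmod u + \<bar>k\<bar> = 1 \<longleftrightarrow> 2 * (a * a + b * b + k * k) + (c * c + d * d) = 2"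
    if "w\<^sup>2 = 4 * k * cnj u"
  proof -
    have "(cmod w)\<^sup>2 = cmod (complex_of_real (4 * k) * cnj u)"
      using that by (metis norm_power)
    also have "\<dots> = 4 * (\<bar>k\<bar> * cmod u)"
      by (simp only: norm_mult norm_of_real complex_mod_cnj abs_mult)
    finally have "c * c + d * d = 4 * (\<bar>k\<bar> * cmod u)"
      using cmod_power2[of w] by (simp add: power2_eq_square ab)
    moreover have "a * a + b * b = cmod u * cmod u"
      using cmod_power2[of u] by (simp add: power2_eq_square ab)
    ultimately have "2 * (a * a + b * b + k * k) + (c * c + d * d) = 2 * (cmod u + \<bar>k\<bar>)\<^sup>2"
      by (simp add: power2_eq_square algebra_simps)
    moreover have "(cmod u + \<bar>k\<bar>)\<^sup>2 = 1 \<longleftrightarrow> cmod u + \<bar>k\<bar> = 1"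
      by (simp add: power2_eq_1_iff) (smt (verit) norm_ge_zero)
    ultimately show ?thesis
      by auto
  qed
  have "x \<in> model \<rho> \<longleftrightarrow> w\<^sup>2 = 4 * k * cnj u \<and> cmod u + \<bar>k\<bar> = 1 \<and> z * w = (k - 1) * u - (cnj u)\<^sup>2"
    by (simp add: x model_def k_def)
  also have "\<dots> \<longleftrightarrow> (c * c - d * d = 4 * k * a \<and> 2 * c * d = - 4 * k * b) \<and>
      2 * (a * a + b * b + k * k) + (c * c + d * d) = 2 \<and>
      z * c = (k - 1) * a - (a * a - b * b) \<and> z * d = (k - 1) * b + 2 * (a * b)"
    using norms unfolding w2 zw by blast
  also have "\<dots> \<longleftrightarrow> ((a - k) * (a - k) + b * b + c * c = 1 \<and> b * b + (a + k) * (a + k) + d * d = 1 \<and>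
      2 * k * b + c * d = 0) \<and>
    a * (a - k) - b * b + z * c = - a \<and> - 2 * a * b - b * k + z * d = - b"
    unfolding left_diff_distrib right_diff_distrib distrib_left distrib_right mult_1
    by (intro iffI; elim conjE; intro conjI; (simp add: mult.commute mult.left_commute; fail | simp add: mult.commute mult.left_commute, linarith))
  finally show ?thesis
    using R by blast
qed

section \<open>Coordinates on the configuration space\<close>

definition ctr_even :: "real^3^6 \<Rightarrow> real^3" where
  "ctr_even P = (1 / 3) *\<^sub>R (P $ 0 + P $ 2 + P $ 4)"

definition ctr_odd :: "real^3^6 \<Rightarrow> real^3" where
  "ctr_odd P = (1 / 3) *\<^sub>R (P $ 1 + P $ 3 + P $ 5)"

definition frame1 :: "real \<Rightarrow> real^3^6 \<Rightarrow> real^3" where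
  "frame1 r P = (1 / r) *\<^sub>R (P $ 0 - ctr_even P)"

definition frame2 :: "real \<Rightarrow> real^3^6 \<Rightarrow> real^3" where
  "frame2 r P = (1 / (r * sqrt 3)) *\<^sub>R (P $ 2 - P $ 4)"

text \<open>The cross product commutes with rotations but not with reflections, which ties the
  coordinates to orientation preserving isometries.\<close>

definition frame3 :: "real \<Rightarrow> real^3^6 \<Rightarrow> real^3" where
  "frame3 r P = cross3 (frame1 r P) (frame2 r P)"

definition odd1 :: "real \<Rightarrow> real^3^6 \<Rightarrow> real^3" where
  "odd1 r P = (1 / r) *\<^sub>R (P $ 3 - ctr_odd P)"

definition odd2 :: "real \<Rightarrow> real^3^6 \<Rightarrow> real^3" where
  "odd2 r P = (1 / (r * sqrt 3)) *\<^sub>R (P $ 5 - P $ 1)"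

definition shift :: "real \<Rightarrow> real^3^6 \<Rightarrow> real^3" where
  "shift r P = (1 / r) *\<^sub>R (ctr_odd P - ctr_even P)"

lemmas frame_defs = ctr_even_def ctr_odd_def frame1_def frame2_def odd1_def odd2_def shift_def

text \<open>Together with \<open>frame_two_triangles\<close> this is a linear change of variables
  between six points and two centres with two vectors for each triangle.\<close>

lemma two_triangles_of_hexagon:
  assumes "r \<noteq> 0"
  shows "two_triangles (ctr_even P) r (frame1 r P) (frame2 r P) (odd1 r P) (odd2 r P) (shift r P) = P"
proof -
  have "\<forall>i. two_triangles (ctr_even P) r (frame1 r P) (frame2 r P) (odd1 r P) (odd2 r P) (shift r P) $ i = P $ i"
    unfolding forall_6 two_triangles_nth frame_defs vec_eq_iff using assms by (simp add: field_simps)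
  then show ?thesis
    by (simp add: vec_eq_iff)
qed

lemma frame_two_triangles:
  assumes "r \<noteq> 0"
  shows "ctr_even (two_triangles c r e1 e2 U V t) = c"
    and "frame1 r (two_triangles c r e1 e2 U V t) = e1"
    and "frame2 r (two_triangles c r e1 e2 U V t) = e2"
    and "odd1 r (two_triangles c r e1 e2 U V t) = U"
    and "odd2 r (two_triangles c r e1 e2 U V t) = V"
    and "shift r (two_triangles c r e1 e2 U V t) = t"
  unfolding two_triangles_nth frame_defs vec_eq_iff using assms by (simp_all add: field_simps)

definition coords :: "real \<Rightarrow> real^3^6 \<Rightarrow> complex \<times> real \<times> complex" where
  "coords r P = (Complex (shift r P \<bullet> frame1 r P) (shift r P \<bullet> frame2 r P), shift r P \<bullet> frame3 r P,
    Complex (odd1 r P \<bullet> frame3 r P) (odd2 r P \<bullet> frame3 r P))"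

text \<open>The normal form of a class: the rigid motion is used up by placing the even triangle in
  standard position.\<close>

definition model_hexagon :: "real \<Rightarrow> complex \<times> real \<times> complex \<Rightarrow> real^3^6" where
  "model_hexagon r x = two_triangles 0 r (vector [1, 0, 0]) (vector [0, 1, 0])
    (model_U (1 / r\<^sup>2) x) (model_V (1 / r\<^sup>2) x) (model_t x)"

lemma sqnorm_model_t: "sqnorm (model_t x) = (cmod (fst x))\<^sup>2 + (fst (snd x))\<^sup>2"
  by (cases x rule: prod_cases3) (simp add: model_t_def inner_vector_3 cmod_power2 flip: power2_eq_square)

lemma model_hexagon_in_hexagons:
  assumes "0 \<le> \<theta>" "\<theta> \<le> pi" "0 < r" "3 * r\<^sup>2 = 2 - 2 * cos \<theta>"
  shows "model_hexagon r x \<in> hexagons \<theta> \<longleftrightarrow> x \<in> model (1 / r\<^sup>2)"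
proof -
  obtain u z and w :: complex where x: "x = (u, z, w)"
    by (cases x rule: prod_cases3)
  have "2 + sqnorm (model_t x) - 1 / r\<^sup>2 = kappa (1 / r\<^sup>2) u z"
    by (simp add: sqnorm_model_t x kappa_def)
  then show ?thesis
    unfolding model_hexagon_def two_triangles_in_hexagons_iff[OF assms] model_iff_vectors
    by (simp add: x model_U_def model_V_def model_t_def inner_vector_3 orthonormal2_def)
qed

lemma coords_model_hexagon:
  assumes "r \<noteq> 0"
  shows "coords r (model_hexagon r x) = x"
proof -
  obtain u z and w :: complex where x: "x = (u, z, w)"
    by (cases x rule: prod_cases3)
  have "cross3 (vector [1, 0, 0]) (vector [0, 1, 0]) = (vector [0, 0, 1] :: real^3)"
    by (simp add: cross3_def)
  then show ?thesis
    unfolding coords_def model_hexagon_def frame3_def frame_two_triangles[OF assms]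
    by (simp add: x model_U_def model_V_def model_t_def inner_vector_3)
qed

lemma rotation_of_orthonormal2:
  assumes "orthonormal2 a b"
  obtains M :: "real^3^3" where "rotation_matrix M" "M *v vector [1, 0, 0] = a"
    "M *v vector [0, 1, 0] = b" "M *v vector [0, 0, 1] = cross3 a b"
proof -
  define Q :: "real^3^3" where "Q = vector [a, b, cross3 a b]"
  have c: "sqnorm (cross3 a b) = 1"
  proof -
    have "(norm (cross3 a b))\<^sup>2 + (a \<bullet> b)\<^sup>2 = (norm a * norm b)\<^sup>2"
      by (rule norm_cross_dot)
    with assms show ?thesis
      by (simp add: orthonormal2_def power2_norm_eq_inner power_mult_distrib)
  qed
  have "orthogonal_matrix Q"
    unfolding orthogonal_matrix_orthonormal_rows
    using assms c by (simp add: Q_def row_def forall_3 orthogonal_def norm_eq_1 orthonormal2_def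
        dot_cross_self inner_commute vec_lambda_eta)
  \<comment> \<open>The triple product of \<open>a\<close>, \<open>b\<close> and their cross product
    is the squared length of the latter.\<close>
  moreover have "det Q = 1"
    unfolding Q_def dot_cross_det[symmetric] using c
    by (metis cross_triple inner_commute)
  ultimately have rot: "rotation_matrix (transpose Q)"
    by (simp add: rotation_matrix_def orthogonal_matrix_transpose det_transpose)
  have "transpose Q *v vector [x, y, z] = x *\<^sub>R a + y *\<^sub>R b + z *\<^sub>R cross3 a b" for x y z
    by (simp add: Q_def matrix_vector_mult_def transpose_def vec_eq_iff sum_3 algebra_simps)
  then show ?thesis
    using that[OF rot] by simp
qed

lemma rotation_inner:
  fixes M :: "real^3^3"
  assumes "rotation_matrix M"
  shows "(M *v x) \<bullet> (M *v y) = x \<bullet> y"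
proof -
  have "orthogonal_transformation ((*v) M)"
    using assms by (simp add: orthogonal_transformation_matrix rotation_matrix_def)
  then show ?thesis
    by (simp add: orthogonal_transformation_def)
qed

lemma two_triangles_rigid:
  fixes M :: "real^3^3"
  shows "(\<chi> i. M *v (two_triangles c r e1 e2 U V t $ i) + d) =
    two_triangles (M *v c + d) r (M *v e1) (M *v e2) (M *v U) (M *v V) (M *v t)"
proof -
  have "\<forall>i. M *v (two_triangles c r e1 e2 U V t $ i) + d =
      two_triangles (M *v c + d) r (M *v e1) (M *v e2) (M *v U) (M *v V) (M *v t) $ i"
    unfolding forall_6 two_triangles_nth
    by (simp add: matrix_vector_right_distrib matrix_vector_mult_diff_distrib matrix_vector_mult_scaleR algebra_simps)
  then show ?thesis
    by (simp add: vec_eq_iff)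
qed

lemma coords_rigid:
  assumes "rotation_matrix M" "r \<noteq> 0"
  shows "coords r (\<chi> i. M *v (P $ i) + d) = coords r P"
proof -
  have "(\<chi> i. M *v (P $ i) + d) = two_triangles (M *v ctr_even P + d) r (M *v frame1 r P)
      (M *v frame2 r P) (M *v odd1 r P) (M *v odd2 r P) (M *v shift r P)"
    by (subst two_triangles_of_hexagon[OF assms(2), of P, symmetric]) (rule two_triangles_rigid)
  then show ?thesis
    unfolding coords_def frame3_def
    by (simp add: frame_two_triangles assms rotation_inner cross_rotation_matrix)
qed

text \<open>\<open>M\<close> carries the standard basis to the frame of \<open>P\<close>. The
  components of \<open>U\<close> and \<open>V\<close> along \<open>e1\<close>, \<open>e2\<close> are
  dictated by the edge equations and those along \<open>e3\<close> are recorded by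
  \<open>coords\<close>, so \<open>M\<close> carries the normal form to \<open>P\<close> up to a
  translation.\<close>

lemma hexagon_eq_rigid_model:
  assumes "0 \<le> \<theta>" "\<theta> \<le> pi" "0 < r" "3 * r\<^sup>2 = 2 - 2 * cos \<theta>" "P \<in> hexagons \<theta>"
  obtains M where "rotation_matrix M" "P = (\<chi> i. M *v (model_hexagon r (coords r P) $ i) + ctr_even P)"
    "coords r P \<in> model (1 / r\<^sup>2)"
proof -
  define e1 e2 e3 U V t where "e1 = frame1 r P" and "e2 = frame2 r P" and "e3 = frame3 r P"
    and "U = odd1 r P" and "V = odd2 r P" and "t = shift r P"
  note d = e1_def[symmetric] e2_def[symmetric] e3_def[symmetric] U_def[symmetric] V_def[symmetric] t_def[symmetric]
  define k where "k = 2 + sqnorm t - 1 / r\<^sup>2"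
  have P: "P = two_triangles (ctr_even P) r e1 e2 U V t"
    using two_triangles_of_hexagon[of r P] assms(3) by (simp add: d)
  have o: "orthonormal2 e1 e2" "orthonormal2 U V" and
    eqs: "e1 \<bullet> U = t \<bullet> e1 - k" "e2 \<bullet> U = - (t \<bullet> e2)" "e1 \<bullet> V = - (t \<bullet> e2)"
      "e2 \<bullet> V = - (t \<bullet> e1) - k" "t \<bullet> U = - (t \<bullet> e1)" "t \<bullet> V = - (t \<bullet> e2)"
    using assms(5) unfolding k_def
    by (subst (asm) P, simp add: two_triangles_in_hexagons_iff[OF assms(1-4)])+
  obtain M where M: "rotation_matrix M" "M *v vector [1, 0, 0] = e1"
    "M *v vector [0, 1, 0] = e2" "M *v vector [0, 0, 1] = e3"
    using rotation_of_orthonormal2[OF o(1)] by (auto simp: e3_def frame3_def d)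
  have MX: "X = M *v vector [X \<bullet> e1, X \<bullet> e2, X \<bullet> e3]" for X
  proof -
    have "M ** transpose M = mat 1"
      using M(1) by (simp add: rotation_matrix_def orthogonal_matrix_def)
    then have X: "X = M *v (transpose M *v X)"
      by (metis matrix_vector_mul_assoc matrix_vector_mul_lid)
    have "transpose M *v X = vector [X \<bullet> e1, X \<bullet> e2, X \<bullet> e3]"
    proof -
      define Y where "Y = transpose M *v X"
      have "X \<bullet> e1 = Y \<bullet> vector [1, 0, 0]" "X \<bullet> e2 = Y \<bullet> vector [0, 1, 0]" "X \<bullet> e3 = Y \<bullet> vector [0, 0, 1]"
        unfolding M(2-4)[symmetric] by (subst X, unfold Y_def[symmetric], rule rotation_inner[OF M(1)])+
      then show ?thesis
        unfolding Y_def[symmetric] by (simp add: vec_eq_iff forall_3 inner_vec_def sum_3)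
    qed
    with X show ?thesis
      by simp
  qed
  define x where "x = coords r P"
  have x: "x = (Complex (t \<bullet> e1) (t \<bullet> e2), t \<bullet> e3, Complex (U \<bullet> e3) (V \<bullet> e3))"
    by (simp add: x_def coords_def d)
  have t: "t = M *v model_t x"
    using MX[of t] by (simp add: x model_t_def)
  \<comment> \<open>\<open>kappa\<close> depends on the shift only through its length, hence it is
    the same before and after \<open>M\<close>.\<close>
  have "sqnorm t = sqnorm (model_t x)"
    unfolding t rotation_inner[OF M(1)] ..
  then have k: "kappa (1 / r\<^sup>2) (fst x) (fst (snd x)) = k"
    by (simp add: k_def kappa_def sqnorm_model_t)
  have U: "U = M *v model_U (1 / r\<^sup>2) x"
    using MX[of U] eqs(1,2) k by (simp add: x model_U_def inner_commute)
  have V: "V = M *v model_V (1 / r\<^sup>2) x"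
    using MX[of V] eqs(3,4) k by (simp add: x model_V_def inner_commute)
  have "x \<in> model (1 / r\<^sup>2)"
    unfolding model_iff_vectors
  proof (intro conjI)
    show "orthonormal2 (model_U (1 / r\<^sup>2) x) (model_V (1 / r\<^sup>2) x)"
      using o(2) unfolding U V orthonormal2_def rotation_inner[OF M(1)] .
    have "t \<bullet> U = model_t x \<bullet> model_U (1 / r\<^sup>2) x" "t \<bullet> V = model_t x \<bullet> model_V (1 / r\<^sup>2) x"
      unfolding U V t rotation_inner[OF M(1)] by (rule refl)+
    with eqs(5,6) show "model_t x \<bullet> model_U (1 / r\<^sup>2) x = - Re (fst x)"
      "model_t x \<bullet> model_V (1 / r\<^sup>2) x = - Im (fst x)"
      by (simp_all add: x)
  qed
  moreover have "P = (\<chi> i. M *v (model_hexagon r x $ i) + ctr_even P)"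
    unfolding model_hexagon_def two_triangles_rigid M(2,3) t[symmetric] U[symmetric] V[symmetric]
    using P by simp
  ultimately show ?thesis
    using that[of M] M(1) unfolding x_def by blast
qed

lemma continuous_on_vector_3 [continuous_intros]:
  assumes "continuous_on S f" "continuous_on S g" "continuous_on S h"
  shows "continuous_on S (\<lambda>x. vector [f x, g x, h x] :: real^3)"
proof -
  have "vector [a, b, c] = a *\<^sub>R vector [1, 0, 0] + b *\<^sub>R vector [0, 1, 0] + c *\<^sub>R (vector [0, 0, 1] :: real^3)"
    for a b c :: real
    by (simp add: vec_eq_iff forall_3)
  then have "(\<lambda>x. vector [f x, g x, h x] :: real^3) = (\<lambda>x. f x *\<^sub>R vector [1, 0, 0] + g x *\<^sub>R vector [0, 1, 0] + h x *\<^sub>R vector [0, 0, 1])"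
    by (rule ext)
  then show ?thesis
    by (simp only:) (intro continuous_intros assms)
qed

lemma continuous_on_coords: "continuous_on S (coords r)"
  unfolding coords_def frame3_def frame_defs
  by (intro continuous_intros continuous_on_cross continuous_on_Complex)

lemma continuous_on_model_hexagon: "continuous_on S (model_hexagon r)"
proof -
  have t: "continuous_on S model_t" and U: "continuous_on S (model_U \<rho>)" and V: "continuous_on S (model_V \<rho>)"
    for \<rho>
    unfolding model_t_def model_U_def model_V_def kappa_def case_prod_unfold
    by (intro continuous_intros)+
  have "\<forall>i. continuous_on S (\<lambda>x. model_hexagon r x $ i)"
    unfolding forall_6 model_hexagon_def two_triangles_nth
    by (intro conjI continuous_intros t U V)
  then have "continuous_on S (\<lambda>x. \<chi> i. model_hexagon r x $ i)"
    by (intro continuous_on_vec_lambda) blast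
  then show ?thesis
    by (simp add: vec_lambda_eta)
qed

section \<open>Classes under rigid motions and the homeomorphism with the model\<close>

lemma rigid_motions_compose:
  assumes "g \<in> rigid_motions" "h \<in> rigid_motions"
  shows "g \<circ> h \<in> rigid_motions"
proof -
  obtain A B :: "real^3^3" and a b where g: "g = (\<lambda>x. A *v x + a)" "rotation_matrix A"
    and h: "h = (\<lambda>x. B *v x + b)" "rotation_matrix B"
    using assms unfolding rigid_motions_eq by blast
  have "g \<circ> h = (\<lambda>x. (A ** B) *v x + (A *v b + a))"
    by (simp add: g h fun_eq_iff matrix_vector_right_distrib matrix_vector_mul_assoc add.assoc)
  moreover have "rotation_matrix (A ** B)"
    using g(2) h(2) by (simp add: rotation_matrix_def orthogonal_matrix_mul det_mul)
  ultimately show ?thesis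
    unfolding rigid_motions_eq by blast
qed

lemma rigid_motions_inverse:
  assumes "g \<in> rigid_motions"
  obtains h where "h \<in> rigid_motions" "\<And>x. h (g x) = x"
proof -
  obtain A :: "real^3^3" and a where g: "g = (\<lambda>x. A *v x + a)" "rotation_matrix A"
    using assms unfolding rigid_motions_eq by blast
  define h where "h = (\<lambda>x. transpose A *v x + - (transpose A *v a))"
  have "transpose A ** A = mat 1"
    using g(2) by (simp add: rotation_matrix_def orthogonal_matrix_def)
  then have "h (g x) = x" for x
    by (simp only: g(1) h_def matrix_vector_right_distrib matrix_vector_mul_assoc
        matrix_vector_mul_lid add.assoc right_minus add_0_right)
  moreover have "rotation_matrix (transpose A)"
    using g(2) by (simp add: rotation_matrix_def orthogonal_matrix_transpose det_transpose)
  then have "h \<in> rigid_motions"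
    unfolding rigid_motions_eq h_def by blast
  ultimately show ?thesis
    using that by blast
qed

lemma id_in_rigid_motions: "(\<lambda>x. x) \<in> rigid_motions"
proof -
  have "rotation_matrix (mat 1 :: real^3^3)"
    by (simp add: rotation_matrix_def orthogonal_matrix_id)
  moreover have "(\<lambda>x. x) = (\<lambda>x. mat 1 *v x + (0 :: real^3))"
    by simp
  ultimately show ?thesis
    unfolding rigid_motions_eq by blast
qed

lemma in_config_class: "P \<in> config_class P"
  unfolding config_class_def using id_in_rigid_motions by (force simp: vec_lambda_eta)

lemma config_class_rigid:
  assumes "g \<in> rigid_motions"
  shows "config_class (\<chi> i. g (P $ i)) = config_class P"
proof
  show "config_class (\<chi> i. g (P $ i)) \<subseteq> config_class P"
  proof
    fix Q assume "Q \<in> config_class (\<chi> i. g (P $ i))"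
    then obtain f where f: "f \<in> rigid_motions" "Q = (\<chi> i. f ((\<chi> i. g (P $ i)) $ i))"
      by (auto simp: config_class_def)
    then have "Q = (\<chi> i. (f \<circ> g) (P $ i))"
      by simp
    then show "Q \<in> config_class P"
      unfolding config_class_def using rigid_motions_compose[OF f(1) assms] by blast
  qed
  obtain h where h: "h \<in> rigid_motions" "\<And>x. h (g x) = x"
    using rigid_motions_inverse[OF assms] by blast
  show "config_class P \<subseteq> config_class (\<chi> i. g (P $ i))"
  proof
    fix Q assume "Q \<in> config_class P"
    then obtain f where f: "f \<in> rigid_motions" "Q = (\<chi> i. f (P $ i))"
      by (auto simp: config_class_def)
    have "Q = (\<chi> i. (f \<circ> h) ((\<chi> i. g (P $ i)) $ i))"
      by (simp add: f h)
    then show "Q \<in> config_class (\<chi> i. g (P $ i))"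
      unfolding config_class_def using rigid_motions_compose[OF f(1) h(1)] by blast
  qed
qed

lemma topspace_config_space: "topspace (config_space \<theta>) = config_class ` hexagons \<theta>"
  using quotient_imp_surjective_map[OF quotient_map_quotient_topology]
  by (metis config_space_def topspace_euclidean_subtopology)

text \<open>The map induced by \<open>coords\<close> on classes; by \<open>coords_rigid\<close> the
  chosen representative does not matter.\<close>

definition class_coords :: "real \<Rightarrow> real \<Rightarrow> (real^3^6) set \<Rightarrow> complex \<times> real \<times> complex" where
  "class_coords \<theta> r c = coords r (SOME P. P \<in> hexagons \<theta> \<and> config_class P = c)"

lemma class_coords_config_class:
  assumes "P \<in> hexagons \<theta>" "r \<noteq> 0"
  shows "class_coords \<theta> r (config_class P) = coords r P"
proof -
  define Q where "Q = (SOME Q. Q \<in> hexagons \<theta> \<and> config_class Q = config_class P)"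
  have "config_class Q = config_class P"
    using someI[of "\<lambda>Q. Q \<in> hexagons \<theta> \<and> config_class Q = config_class P" P] assms(1)
    by (simp add: Q_def)
  then have "Q \<in> config_class P"
    using in_config_class by blast
  then obtain M d where "rotation_matrix M" "Q = (\<chi> i. M *v (P $ i) + d)"
    by (auto simp: config_class_def rigid_motions_eq)
  then show ?thesis
    using coords_rigid[OF _ assms(2)] by (simp add: class_coords_def Q_def[symmetric])
qed

text \<open>One direction is continuous by the universal property of the quotient map, the other
  because it is the continuous section \<open>model_hexagon\<close> followed by the projection to
  classes.\<close>

lemma homeomorphic_map_class_coords:
  assumes "0 \<le> \<theta>" "\<theta> \<le> pi" "0 < r" "3 * r\<^sup>2 = 2 - 2 * cos \<theta>"
  shows "homeomorphic_map (config_space \<theta>) (top_of_set (model (1 / r\<^sup>2))) (class_coords \<theta> r)"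
proof -
  let ?H = "top_of_set (hexagons \<theta>)" and ?M = "top_of_set (model (1 / r\<^sup>2))"
  have r: "r \<noteq> 0"
    using assms(3) by simp
  have q: "quotient_map ?H (config_space \<theta>) config_class"
    unfolding config_space_def by (rule quotient_map_quotient_topology)
  have coords: "coords r P \<in> model (1 / r\<^sup>2)" if "P \<in> hexagons \<theta>" for P
    using hexagon_eq_rigid_model[OF assms that] by blast
  have cls: "config_class (model_hexagon r (coords r P)) = config_class P" if P: "P \<in> hexagons \<theta>" for P
  proof -
    obtain M where M: "rotation_matrix M"
        "P = (\<chi> i. M *v (model_hexagon r (coords r P) $ i) + ctr_even P)"
      using hexagon_eq_rigid_model[OF assms P] by blast
    then have "(\<lambda>x. M *v x + ctr_even P) \<in> rigid_motions"
      unfolding rigid_motions_eq by blast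
    from config_class_rigid[OF this, of "model_hexagon r (coords r P)"] M(2) show ?thesis
      by simp
  qed
  have "homeomorphic_maps (config_space \<theta>) ?M (class_coords \<theta> r) (config_class \<circ> model_hexagon r)"
    unfolding homeomorphic_maps_def
  proof (intro conjI ballI)
    show "continuous_map (config_space \<theta>) ?M (class_coords \<theta> r)"
    proof (rule continuous_compose_quotient_map[OF q])
      have "continuous_map ?H ?M (coords r)"
        using coords by (auto simp: continuous_on_coords)
      then show "continuous_map ?H ?M (class_coords \<theta> r \<circ> config_class)"
        by (rule continuous_map_eq) (simp add: class_coords_config_class r)
    qed
    have "continuous_map ?M ?H (model_hexagon r)"
      by (auto simp: continuous_on_model_hexagon model_hexagon_in_hexagons[OF assms])
    then show "continuous_map ?M (config_space \<theta>) (config_class \<circ> model_hexagon r)"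
      using quotient_imp_continuous_map[OF q] by (rule continuous_map_compose)
    show "(config_class \<circ> model_hexagon r) (class_coords \<theta> r c) = c" if "c \<in> topspace (config_space \<theta>)" for c
      using that by (auto simp: topspace_config_space class_coords_config_class r cls)
    show "class_coords \<theta> r ((config_class \<circ> model_hexagon r) x) = x" if "x \<in> topspace ?M" for x
      using that by (simp add: class_coords_config_class coords_model_hexagon r model_hexagon_in_hexagons[OF assms])
  qed
  then show ?thesis
    by (rule homeomorphic_maps_imp_map)
qed

lemma in_circle_component_homeomorphic:
  assumes h: "homeomorphic_map X Y f" and x: "x \<in> topspace X" "in_circle_component Y (f x)"
  shows "in_circle_component X x"
proof -
  obtain C where C: "C \<in> connected_components_of Y" "f x \<in> C" "subtopology Y C homeomorphic_space circle_space"
    using x(2) by (auto simp: in_circle_component_def)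
  obtain D where D: "D \<in> connected_components_of X" "C = f ` D"
    using C(1) homeomorphic_map_connected_components_of[OF h] by auto
  have sub: "D \<subseteq> topspace X"
    using D(1) connected_components_of_subset by blast
  have "x \<in> D"
    using C(2) D(2) sub x(1) homeomorphic_imp_injective_map[OF h] by (auto dest: inj_onD)
  moreover have "homeomorphic_map (subtopology X D) (subtopology Y C) f"
    using h sub C(1) D(2) connected_components_of_subset[OF C(1)]
    by (intro homeomorphic_map_subtopologies) (auto simp: inf.absorb2)
  then have "subtopology X D homeomorphic_space circle_space"
    using C(3) homeomorphic_map_imp_homeomorphic_space homeomorphic_space_trans by blast
  ultimately show ?thesis
    using D(1) by (auto simp: in_circle_component_def)
qed

section \<open>Boats and chairs\<close>

lemma orthogonal_to_three_is_zero:
  fixes X :: "real^3"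
  assumes "a \<noteq> 0" "b \<noteq> 0" "c \<noteq> 0" "a \<bullet> b = 0" "a \<bullet> c = 0" "b \<bullet> c = 0"
    and "X \<bullet> a = 0" "X \<bullet> b = 0" "X \<bullet> c = 0"
  shows "X = 0"
proof (rule ccontr)
  assume X: "X \<noteq> 0"
  have "pairwise orthogonal {X, a, b, c}"
    using assms by (auto simp: pairwise_def orthogonal_def inner_commute)
  then have "independent {X, a, b, c}"
    using assms X by (intro pairwise_orthogonal_independent) auto
  then have "card {X, a, b, c} \<le> 3"
    using independent_bound[of "{X, a, b, c}"] by simp
  moreover have "X \<noteq> a" "X \<noteq> b" "X \<noteq> c" "a \<noteq> b" "a \<noteq> c" "b \<noteq> c"
    using assms X by auto
  ultimately show False
    by simp
qed

text \<open>Parseval's identity in the orthogonal basis \<open>D\<close>, \<open>E\<close>,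
  \<open>n\<close>, where the term for \<open>E\<close> drops out; \<open>n\<close> is any normal,
  hence the division.\<close>

lemma inner_orthogonal_expansion:
  fixes X Y D E n :: "real^3"
  assumes "sqnorm D = 1" "E \<noteq> 0" "n \<noteq> 0" "D \<bullet> E = 0" "D \<bullet> n = 0" "E \<bullet> n = 0" "X \<bullet> E = 0"
  shows "X \<bullet> Y = (X \<bullet> D) * (Y \<bullet> D) + (X \<bullet> n) * (Y \<bullet> n) / sqnorm n"
proof -
  define Z where "Z = X - (X \<bullet> D) *\<^sub>R D - ((X \<bullet> n) / sqnorm n) *\<^sub>R n"
  have "D \<noteq> 0" and n: "sqnorm n \<noteq> 0"
    using assms by auto
  moreover have "Z \<bullet> D = 0" "Z \<bullet> E = 0" "Z \<bullet> n = 0"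
    using assms n by (simp_all add: Z_def inner_diff_left inner_diff_right inner_commute)
  ultimately have "Z = 0"
    using assms by (intro orthogonal_to_three_is_zero[of D E n]) auto
  then have "X = (X \<bullet> D) *\<^sub>R D + ((X \<bullet> n) / sqnorm n) *\<^sub>R n"
    by (simp add: Z_def algebra_simps)
  then have "X \<bullet> Y = ((X \<bullet> D) *\<^sub>R D + ((X \<bullet> n) / sqnorm n) *\<^sub>R n) \<bullet> Y"
    by simp
  then show ?thesis
    by (simp add: inner_add_left inner_add_right inner_commute)
qed

text \<open>
  By the side lengths, \<open>a, b, c, d\<close> are the vertices of a rectangle, and \<open>p\<close> and \<open>q\<close>, with heights
  \<open>n \<bullet> p - h\<close> and \<open>n \<bullet> q - h\<close> over its plane, lie over its axis of symmetry.
\<close>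

lemma folded_rectangle_diagonals:
  fixes a b c d p q n :: "real^3"
  assumes par: "d - a = c - b"
    and sides: "sqnorm (a - d) = 1" "sqnorm (a - b) = s" "0 < s"
    and p: "sqnorm (p - a) = 1" "sqnorm (p - b) = 1" "sqnorm (p - c) = s" "sqnorm (p - d) = s"
    and q: "sqnorm (q - c) = 1" "sqnorm (q - d) = 1" "sqnorm (q - a) = s" "sqnorm (q - b) = s"
    and n: "n \<noteq> 0" "n \<bullet> a = h" "n \<bullet> b = h" "n \<bullet> c = h" "n \<bullet> d = h"
  shows "sqnorm (a - c) = 1 + s" "sqnorm (b - d) = 1 + s"
    and "sqnorm (p - q) = 1 + s - 2 * ((n \<bullet> p - h) * ((n \<bullet> p - h) + (n \<bullet> q - h))) / sqnorm n"
    and "(n \<bullet> p - h)\<^sup>2 = (n \<bullet> q - h)\<^sup>2"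
proof -
  \<comment> \<open>With the origin at the midpoint of \<open>a\<close> and \<open>b\<close>, the
    eight distance conditions become linear in the inner products of \<open>X\<close>,
    \<open>Y\<close>, \<open>D\<close>, \<open>E\<close>. They force
    \<open>D \<bullet> E = 0\<close>, the rectangle, and put \<open>X\<close> and \<open>Y\<close>
    over its axis.\<close>
  define E D X Y where "E = b - a" and "D = d - a" and "X = p - (1 / 2) *\<^sub>R (a + b)" and "Y = q - (1 / 2) *\<^sub>R (a + b)"
  have vs: "p - a = X + (1 / 2) *\<^sub>R E" "p - b = X - (1 / 2) *\<^sub>R E"
    "p - d = X + (1 / 2) *\<^sub>R E - D" "q - a = Y + (1 / 2) *\<^sub>R E" "q - b = Y - (1 / 2) *\<^sub>R E"
    "q - d = Y + (1 / 2) *\<^sub>R E - D" "a - b = - E" "a - d = - D" "b - d = E - D" "p - q = X - Y"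
    by (auto simp: E_def D_def X_def Y_def vec_eq_iff field_simps)
  have c: "c = b + D"
    using par by (simp add: D_def algebra_simps)
  have vc: "p - c = X - (1 / 2) *\<^sub>R E - D" "q - c = Y - (1 / 2) *\<^sub>R E - D" "a - c = - E - D"
    by (auto simp: c E_def X_def Y_def vec_eq_iff field_simps)
  note ex = inner_add_left inner_add_right inner_diff_left inner_diff_right inner_minus_left inner_minus_right
    inner_scaleR_left inner_scaleR_right inner_commute[of E X]
    inner_commute[of E Y] inner_commute[of E D] inner_commute[of D X] inner_commute[of D Y] inner_commute[of Y X]
  have E: "sqnorm E = s" and D: "sqnorm D = 1"
    using sides unfolding vs by simp_all
  have half: "sqnorm (Z + (1 / 2) *\<^sub>R E) = sqnorm Z + Z \<bullet> E + sqnorm E / 4"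
    "sqnorm (Z - (1 / 2) *\<^sub>R E) = sqnorm Z - Z \<bullet> E + sqnorm E / 4"
    "sqnorm (Z - (1 / 2) *\<^sub>R E - D) = sqnorm Z - Z \<bullet> E + sqnorm E / 4 + sqnorm D - 2 * (Z \<bullet> D) + D \<bullet> E"
    "sqnorm (Z + (1 / 2) *\<^sub>R E - D) = sqnorm Z + Z \<bullet> E + sqnorm E / 4 + sqnorm D - 2 * (Z \<bullet> D) - D \<bullet> E"
    for Z
    unfolding ex inner_commute[of E Z] inner_commute[of D Z] by (simp_all add: field_simps)
  note pq = p[unfolded vs vc half E D] q[unfolded vs vc half E D]
  have ED: "X \<bullet> E = 0" "Y \<bullet> E = 0" "D \<bullet> E = 0" "sqnorm X = 1 - s / 4" "X \<bullet> D = 1 - s / 2"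
    "sqnorm Y = 3 * s / 4" "Y \<bullet> D = s / 2"
    using pq by linarith+
  show "sqnorm (a - c) = 1 + s" "sqnorm (b - d) = 1 + s"
    unfolding vs vc using ED E D by (simp_all add: ex)
  have n': "E \<bullet> n = 0" "D \<bullet> n = 0"
    using n by (simp_all add: E_def D_def inner_diff_left inner_diff_right inner_commute)
  have nX: "X \<bullet> n = n \<bullet> p - h" and nY: "Y \<bullet> n = n \<bullet> q - h"
    using n by (simp_all add: X_def Y_def inner_diff_left inner_diff_right inner_add_left inner_add_right inner_commute)
  have E0: "E \<noteq> 0"
    using E sides(3) by auto
  define x y where "x = X \<bullet> n" and "y = Y \<bullet> n"
  define N where "N = sqnorm n"
  have N: "N > 0"
    using n(1) by (simp add: N_def)
  note exp = inner_orthogonal_expansion[OF D E0 n(1) ED(3) n'(2,1)]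
  have XX: "1 - s / 4 = (1 - s / 2)\<^sup>2 + x\<^sup>2 / N" and YY: "3 * s / 4 = (s / 2)\<^sup>2 + y\<^sup>2 / N"
    and XY: "X \<bullet> Y = (1 - s / 2) * (s / 2) + x * y / N"
    using exp[OF ED(1), of X] exp[OF ED(2), of Y] exp[OF ED(1), of Y] ED
    by (simp_all add: x_def y_def N_def power2_eq_square)
  have "x\<^sup>2 / N = y\<^sup>2 / N"
    using XX YY by (simp add: power2_eq_square algebra_simps)
  then have xy: "x\<^sup>2 = y\<^sup>2"
    using N by simp
  then show "(n \<bullet> p - h)\<^sup>2 = (n \<bullet> q - h)\<^sup>2"
    by (simp add: x_def y_def nX nY)
  \<comment> \<open>This trades the quadratic term in \<open>s\<close> for the squared height, so
    that the length of \<open>p - q\<close> shows the factor \<open>x + y\<close> deciding between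
    boat and chair.\<close>
  have xN: "x\<^sup>2 / N = 3 * s / 4 - s\<^sup>2 / 4"
    using XX by (simp add: power2_eq_square algebra_simps)
  have "sqnorm (p - q) = sqnorm X + sqnorm Y - 2 * (X \<bullet> Y)"
    unfolding vs by (simp add: inner_diff_left inner_diff_right inner_commute)
  also have "\<dots> = 1 - s / 2 + s\<^sup>2 / 2 - 2 * (x * y / N)"
    unfolding ED XY by (simp add: power2_eq_square algebra_simps)
  also have "\<dots> = 1 + s - 2 * (x\<^sup>2 / N) - 2 * (x * y / N)"
    unfolding xN by (simp add: algebra_simps)
  also have "\<dots> = 1 + s - 2 * (x * (x + y)) / N"
    by (simp add: power2_eq_square add_divide_distrib algebra_simps)
  finally show "sqnorm (p - q) = 1 + s - 2 * ((n \<bullet> p - h) * ((n \<bullet> p - h) + (n \<bullet> q - h))) / sqnorm n"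
    by (simp only: x_def y_def nX nY N_def)
qed

text \<open>A condition symmetric in the labels. \<open>coords\<close> singles out vertex 0, while a
  boat or chair may sit at any index; this notion links the two without relabelling.\<close>

definition equal_diagonals :: "real^3^6 \<Rightarrow> bool" where
  "equal_diagonals P \<longleftrightarrow> (\<forall>i j. sqnorm (P $ i - P $ (i + 3)) = sqnorm (P $ j - P $ (j + 3)))"

text \<open>Two of the long diagonals are the diagonals of the base rectangle; the third joins the
  two tips and is the only one that sees their heights.\<close>

lemma parallelogram_base_diagonals:
  assumes P: "P \<in> hexagons \<theta>" and \<theta>: "0 < \<theta>" "\<theta> \<le> pi" and base: "parallelogram_base P i"
    and n: "n \<noteq> 0" "affine hull base_points P i = {z. n \<bullet> z = h}"
  defines "s \<equiv> 2 - 2 * cos \<theta>" and "x \<equiv> n \<bullet> P $ i - h" and "y \<equiv> n \<bullet> P $ (i + 3) - h"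
  shows "sqnorm (P $ (i + 1) - P $ (i + 1 + 3)) = 1 + s"
    and "sqnorm (P $ (i + 2) - P $ (i + 2 + 3)) = 1 + s"
    and "sqnorm (P $ i - P $ (i + 3)) = 1 + s - 2 * (x * (x + y)) / sqnorm n"
    and "x\<^sup>2 = y\<^sup>2"
proof -
  have H: "sqnorm (P $ j - P $ (j + 1)) = 1" "sqnorm (P $ (j - 1) - P $ (j + 1)) = s" for j
    using P \<theta> by (simp_all add: hexagons_iff s_def)
  have H': "sqnorm (P $ (j + 1) - P $ j) = 1" "sqnorm (P $ (j + 1) - P $ (j - 1)) = s" for j
    using H by (simp_all add: sqnorm_commute)
  have "cos \<theta> < 1"
    using cos_monotone_0_pi[of 0 \<theta>] \<theta> by simp
  then have s: "0 < s"
    by (simp add: s_def)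
  have pl: "n \<bullet> P $ (i - 1) = h" "n \<bullet> P $ (i + 1) = h" "n \<bullet> P $ (i + 2) = h" "n \<bullet> P $ (i - 2) = h"
    using hull_subset[of "base_points P i" affine] n(2) by (auto simp: base_points_def)
  have ix: "i + 1 + 3 = i - 2" "i + 2 + 3 = i - 1"
  proof -
    have "(6::6) = 0" by simp
    then show "i + 1 + 3 = i - 2" "i + 2 + 3 = i - 1"
      by (simp_all add: algebra_simps)
  qed
  have jx: "i - 2 + 1 = i - 1" "i + 2 + 1 = i + 3" "i + 1 + 1 = i + 2" "i + 3 + 1 = i - 2" "i - 1 + 1 = i"
    "i - 1 - 1 = i - 2" "i + 1 - 1 = i" "i + 3 - 1 = i + 2" "i + 2 - 1 = i + 1" "i - 2 - 1 = i + 3" "i - 3 = i + 3"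
  proof -
    have "(6::6) = 0" by simp
    then show "i - 2 + 1 = i - 1" "i + 2 + 1 = i + 3" "i + 1 + 1 = i + 2" "i + 3 + 1 = i - 2" "i - 1 + 1 = i"
      "i - 1 - 1 = i - 2" "i + 1 - 1 = i" "i + 3 - 1 = i + 2" "i + 2 - 1 = i + 1" "i - 2 - 1 = i + 3" "i - 3 = i + 3"
      by (simp_all add: algebra_simps)
  qed
  note F = folded_rectangle_diagonals[where a = "P $ (i - 1)" and b = "P $ (i + 1)" and c = "P $ (i + 2)"
      and d = "P $ (i - 2)" and p = "P $ i" and q = "P $ (i + 3)" and s = s and n = n and h = h]
  have par: "P $ (i - 2) - P $ (i - 1) = P $ (i + 2) - P $ (i + 1)"
    using base by (simp add: parallelogram_base_def)
  have d: "sqnorm (P $ (i - 1) - P $ (i - 2)) = 1" "sqnorm (P $ (i - 1) - P $ (i + 1)) = s"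
    "sqnorm (P $ i - P $ (i - 1)) = 1" "sqnorm (P $ i - P $ (i + 1)) = 1"
    "sqnorm (P $ i - P $ (i + 2)) = s" "sqnorm (P $ i - P $ (i - 2)) = s"
    "sqnorm (P $ (i + 3) - P $ (i + 2)) = 1" "sqnorm (P $ (i + 3) - P $ (i - 2)) = 1"
    "sqnorm (P $ (i + 3) - P $ (i - 1)) = s" "sqnorm (P $ (i + 3) - P $ (i + 1)) = s"
    using H'(1)[of "i - 2", unfolded jx] H(2)[of i] H'(1)[of "i - 1", unfolded jx] H(1)[of i]
      H(2)[of "i + 1", unfolded jx] H'(2)[of "i - 1", unfolded jx] H'(1)[of "i + 2", unfolded jx]
      H(1)[of "i + 3", unfolded jx] H(2)[of "i - 2", unfolded jx] H'(2)[of "i + 2", unfolded jx]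
    by simp_all
  note F = F[OF par d(1,2) s d(3-10) n(1) pl]
  show "sqnorm (P $ (i + 1) - P $ (i + 1 + 3)) = 1 + s" "sqnorm (P $ (i + 2) - P $ (i + 2 + 3)) = 1 + s"
    unfolding ix using F(1,2) by (simp_all add: sqnorm_commute)
  show "sqnorm (P $ i - P $ (i + 3)) = 1 + s - 2 * (x * (x + y)) / sqnorm n" "x\<^sup>2 = y\<^sup>2"
    using F(3,4) by (simp_all add: x_def y_def)
qed

text \<open>Heights of equal square and opposite sign satisfy \<open>x + y = 0\<close>, so the
  correction to the third diagonal vanishes.\<close>

lemma chair_equal_diagonals:
  assumes P: "P \<in> hexagons \<theta>" and \<theta>: "0 < \<theta>" "\<theta> \<le> pi" and "chair P"
  shows "equal_diagonals P"
proof -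
  obtain i n h where i: "parallelogram_base P i" and n: "n \<noteq> 0" "affine hull base_points P i = {z. n \<bullet> z = h}"
    "n \<bullet> P $ i > h" "n \<bullet> P $ (i + 3) < h"
    using assms(4) unfolding chair_def strictly_opposite_sides_def by blast
  note F = parallelogram_base_diagonals[OF P \<theta> i n(1,2)]
  have "n \<bullet> P $ i - h = - (n \<bullet> P $ (i + 3) - h)"
    using F(4) n(3,4) by (auto simp: power2_eq_iff)
  then have 0: "sqnorm (P $ i - P $ (i + 3)) = 1 + (2 - 2 * cos \<theta>)"
    using F(3) by simp
  have "(6::6) = 0" by simp
  then have ix: "i + 3 + 3 = i" "i + 4 + 3 = i + 1" "i + 5 + 3 = i + 2" "i + 1 + 3 = i + 4" "i + 2 + 3 = i + 5"
    by (simp_all add: algebra_simps)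
  have "sqnorm (P $ j - P $ (j + 3)) = 1 + (2 - 2 * cos \<theta>)" for j
  proof -
    have "j = i \<or> j = i + 1 \<or> j = i + 2 \<or> j = i + 3 \<or> j = i + 4 \<or> j = i + 5"
      using exhaust_6[of "j - i"] by (auto simp: algebra_simps)
    then show ?thesis
      using 0 F(1,2) ix sqnorm_commute by metis
  qed
  then show ?thesis
    by (simp add: equal_diagonals_def)
qed

text \<open>Both heights are positive, so the third diagonal is strictly shorter than the other
  two.\<close>

lemma boat_not_equal_diagonals:
  assumes P: "P \<in> hexagons \<theta>" and \<theta>: "0 < \<theta>" "\<theta> \<le> pi" and "boat P"
  shows "\<not> equal_diagonals P"
proof
  assume eq: "equal_diagonals P"
  obtain i n h where i: "parallelogram_base P i" and n: "n \<noteq> 0" "affine hull base_points P i = {z. n \<bullet> z = h}"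
    "n \<bullet> P $ i > h" "n \<bullet> P $ (i + 3) > h"
    using assms(4) unfolding boat_def strictly_same_side_def by blast
  note F = parallelogram_base_diagonals[OF P \<theta> i n(1,2)]
  have "sqnorm (P $ i - P $ (i + 3)) = sqnorm (P $ (i + 1) - P $ (i + 1 + 3))"
    using eq unfolding equal_diagonals_def by blast
  then have "(n \<bullet> P $ i - h) * ((n \<bullet> P $ i - h) + (n \<bullet> P $ (i + 3) - h)) / sqnorm n = 0"
    using F(1,3) by simp
  moreover have "(n \<bullet> P $ i - h) * ((n \<bullet> P $ i - h) + (n \<bullet> P $ (i + 3) - h)) / sqnorm n > 0"
    using n by (intro divide_pos_pos mult_pos_pos) auto
  ultimately show False
    by (metis less_irrefl)
qed

text \<open>Divided by \<open>r^2\<close>, the squared diagonals are a common constant minus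
  \<open>6 * Re (u * cnj \<omega>)\<close>, with \<open>\<omega>\<close> running through the cube
  roots of unity. These three real parts agree only for \<open>u = 0\<close>.\<close>

lemma equal_diagonals_iff_coords:
  assumes "0 \<le> \<theta>" "\<theta> \<le> pi" "0 < r" "3 * r\<^sup>2 = 2 - 2 * cos \<theta>" "P \<in> hexagons \<theta>"
  shows "equal_diagonals P \<longleftrightarrow> fst (coords r P) = 0"
proof -
  define c e1 e2 U V t where "c = ctr_even P" and "e1 = frame1 r P" and "e2 = frame2 r P"
    and "U = odd1 r P" and "V = odd2 r P" and "t = shift r P"
  define k where "k = 2 + sqnorm t - 1 / r\<^sup>2"
  have P: "P = two_triangles c r e1 e2 U V t"
    using two_triangles_of_hexagon[of r P] assms(3)
    by (simp add: c_def e1_def e2_def U_def V_def t_def)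
  have "two_triangles c r e1 e2 U V t \<in> hexagons \<theta>"
    using assms(5) P by simp
  then have o: "orthonormal2 e1 e2" "orthonormal2 U V" and
    eqs: "e1 \<bullet> U = t \<bullet> e1 - k" "e2 \<bullet> U = - (t \<bullet> e2)" "e1 \<bullet> V = - (t \<bullet> e2)"
      "e2 \<bullet> V = - (t \<bullet> e1) - k" "t \<bullet> U = - (t \<bullet> e1)" "t \<bullet> V = - (t \<bullet> e2)"
    unfolding two_triangles_in_hexagons_iff[OF assms(1-4)] k_def by blast+
  define s where "s = sqrt 3 / 2"
  have s: "s * s = 3 / 4" "s \<noteq> 0"
    by (auto simp: s_def)
  have o': "e1 \<bullet> e1 = 1" "e2 \<bullet> e2 = 1" "e1 \<bullet> e2 = 0" "U \<bullet> U = 1" "V \<bullet> V = 1" "U \<bullet> V = 0"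
      "e2 \<bullet> e1 = 0" "V \<bullet> U = 0"
    using o by (auto simp: orthonormal2_def inner_commute)
  have comm: "U \<bullet> e1 = e1 \<bullet> U" "U \<bullet> e2 = e2 \<bullet> U" "V \<bullet> e1 = e1 \<bullet> V" "V \<bullet> e2 = e2 \<bullet> V"
      "e1 \<bullet> t = t \<bullet> e1" "e2 \<bullet> t = t \<bullet> e2" "U \<bullet> t = t \<bullet> U" "V \<bullet> t = t \<bullet> V"
    by (simp_all add: inner_commute)
  note ex = inner_diff_left inner_diff_right inner_add_left inner_add_right inner_minus_left
    inner_minus_right inner_scaleR_left inner_scaleR_right o' comm eqs
  define a1 a2 b1 b2 where "a1 = - (1 / 2) *\<^sub>R e1 + s *\<^sub>R e2" and "a2 = - (1 / 2) *\<^sub>R e1 - s *\<^sub>R e2"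
    and "b1 = t - (1 / 2) *\<^sub>R U + s *\<^sub>R V" and "b2 = t - (1 / 2) *\<^sub>R U - s *\<^sub>R V"
  have "sqnorm (e1 - (t + U)) = 2 + sqnorm t + 2 * k - 6 * (t \<bullet> e1)"
    unfolding ex by (simp add: algebra_simps)
  moreover have "sqnorm (a2 - b2) = 1 / 2 + 2 * (s * s) + sqnorm t + k / 2 + 2 * (s * s) * k + (3 / 2 + 2 * (s * s)) * (t \<bullet> e1) + 6 * (s * (t \<bullet> e2))"
    unfolding a2_def b2_def ex by (simp add: field_simps)
  moreover have "sqnorm (a1 - b1) = 1 / 2 + 2 * (s * s) + sqnorm t + k / 2 + 2 * (s * s) * k + (3 / 2 + 2 * (s * s)) * (t \<bullet> e1) - 6 * (s * (t \<bullet> e2))"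
    unfolding a1_def b1_def ex by (simp add: field_simps)
  ultimately have D: "sqnorm (e1 - (t + U)) = 2 + sqnorm t + 2 * k - 6 * (t \<bullet> e1)"
    "sqnorm (a2 - b2) = 2 + sqnorm t + 2 * k + 3 * (t \<bullet> e1) + 6 * (s * (t \<bullet> e2))"
    "sqnorm (a1 - b1) = 2 + sqnorm t + 2 * k + 3 * (t \<bullet> e1) - 6 * (s * (t \<bullet> e2))"
    unfolding s(1) by simp_all
  have diag: "sqnorm (P $ 0 - P $ 3) = r\<^sup>2 * sqnorm (e1 - (t + U))"
    "sqnorm (P $ 1 - P $ 4) = r\<^sup>2 * sqnorm (a2 - b2)" "sqnorm (P $ 2 - P $ 5) = r\<^sup>2 * sqnorm (a1 - b1)"
    unfolding P two_triangles_nth sqnorm_scaled_diff s_def[symmetric] a1_def b1_def a2_def b2_def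
    by (simp_all add: sqnorm_commute)
  have ix: "(0::6) + 3 = 3" "(1::6) + 3 = 4" "(2::6) + 3 = 5" "(3::6) + 3 = 0" "(4::6) + 3 = 1" "(5::6) + 3 = 2"
    by simp_all
  have "equal_diagonals P \<longleftrightarrow> sqnorm (P $ 0 - P $ 3) = sqnorm (P $ 1 - P $ 4) \<and> sqnorm (P $ 1 - P $ 4) = sqnorm (P $ 2 - P $ 5)"
    unfolding equal_diagonals_def forall_6 ix sqnorm_commute[of "P $ 3"] sqnorm_commute[of "P $ 4"] sqnorm_commute[of "P $ 5"]
    by metis
  also have "\<dots> \<longleftrightarrow> t \<bullet> e1 = 0 \<and> s * (t \<bullet> e2) = 0"
    unfolding diag D using assms(3) by auto
  also have "\<dots> \<longleftrightarrow> fst (coords r P) = 0"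
    using s(2) by (simp add: coords_def complex_eq_iff t_def e1_def e2_def)
  finally show ?thesis .
qed

section \<open>The classification\<close>

lemma config_space_empty:
  assumes "hexagons \<theta> = {}"
  shows "config_space \<theta> = trivial_topology"
  by (metis assms image_empty null_topspace_iff_trivial topspace_config_space)

text \<open>At angle 0 all even vertices coincide, and so do all odd ones: the hexagon is a unit
  segment traversed back and forth. Rotations act transitively on unit vectors, so there is one
  class.\<close>

lemma config_space_0: "config_space 0 homeomorphic_space point_space"
proof -
  have iff: "P \<in> hexagons 0 \<longleftrightarrow> (\<forall>i. sqnorm (P $ i - P $ (i + 1)) = 1 \<and> P $ (i - 1) = P $ (i + 1))" for P
    using hexagons_iff[of 0 P] by simp
  have card3: "2 \<le> CARD(3)"
    by simp
  define u :: "real^3" where "u = axis 1 1"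
  have u: "norm u = 1"
    by (simp add: u_def)
  define P0 :: "real^3^6" where "P0 = hex6 0 u 0 u 0 u"
  have ix: "(0::6) - 1 = 5" "(1::6) - 1 = 0" "(2::6) - 1 = 1" "(3::6) - 1 = 2" "(4::6) - 1 = 3" "(5::6) - 1 = 4"
     "(0::6) + 1 = 1" "(1::6) + 1 = 2" "(2::6) + 1 = 3" "(3::6) + 1 = 4" "(4::6) + 1 = 5" "(5::6) + 1 = 0"
    by simp_all
  have "P0 \<in> hexagons 0"
    unfolding iff forall_6 ix using u by (simp add: P0_def norm_eq_1)
  then have ne: "hexagons 0 \<noteq> {}"
    by blast
  have cls: "config_class P = config_class P0" if P: "P \<in> hexagons 0" for P
  proof -
    define a b where "a = P $ 0" and "b = P $ 1"
    have "P $ 0 = P $ 2" "P $ 1 = P $ 3" "P $ 2 = P $ 4" "P $ 3 = P $ 5" "sqnorm (P $ 0 - P $ 1) = 1"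
      using P[unfolded iff forall_6 ix] by blast+
    then have ev: "P $ 2 = a" "P $ 3 = b" "P $ 4 = a" "P $ 5 = b" and ab: "sqnorm (a - b) = 1"
      unfolding a_def b_def by simp_all
    have "norm u = norm (b - a)"
      using u ab norm_eq_1[of "a - b"] norm_minus_commute[of a b] by simp
    then obtain f where f: "orthogonal_transformation f" "det (matrix f) = 1" "f u = b - a"
      using rotation_exists[where a = u and b = "b - a"] card3 by blast
    have lin: "linear f"
      using f(1) orthogonal_transformation_linear by blast
    have "rotation_matrix (matrix f)"
      using f by (simp add: rotation_matrix_def orthogonal_transformation_matrix)
    then have "(\<lambda>x. matrix f *v x + a) \<in> rigid_motions"
      unfolding rigid_motions_eq by blast
    moreover have "matrix f *v x = f x" for x
      using matrix_works[of f x] lin by (simp add: linear_matrix_vector_mul_eq)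
    ultimately have g: "(\<lambda>x. f x + a) \<in> rigid_motions"
      by simp
    have "\<forall>i. f (P0 $ i) + a = P $ i"
      unfolding forall_6 using linear_0[OF lin] f(3) ev by (simp add: P0_def a_def b_def)
    then have "(\<chi> i. f (P0 $ i) + a) = P"
      by (simp add: vec_eq_iff)
    with config_class_rigid[OF g, of P0] show ?thesis
      by simp
  qed
  have "config_class ` hexagons 0 = (\<lambda>_. config_class P0) ` hexagons 0"
    by (rule image_cong[OF refl cls])
  then have "topspace (config_space 0) = {config_class P0}"
    unfolding topspace_config_space using ne by (simp add: image_constant_conv)
  then show ?thesis
    using singleton_homeomorphic_point_space[of "config_class P0" "config_space 0"]
      subtopology_topspace[of "config_space 0"] by simp
qed

lemma radius_of_angle:
  assumes "0 < \<theta>" "\<theta> \<le> pi"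
  obtains r where "0 < r" "3 * r\<^sup>2 = 2 - 2 * cos \<theta>" "1 / r\<^sup>2 = 3 / (2 - 2 * cos \<theta>)"
proof
  define r where "r = sqrt ((2 - 2 * cos \<theta>) / 3)"
  have "cos \<theta> < 1"
    using cos_monotone_0_pi[of 0 \<theta>] assms by simp
  then show "0 < sqrt ((2 - 2 * cos \<theta>) / 3)" "3 * (sqrt ((2 - 2 * cos \<theta>) / 3))\<^sup>2 = 2 - 2 * cos \<theta>"
    "1 / (sqrt ((2 - 2 * cos \<theta>) / 3))\<^sup>2 = 3 / (2 - 2 * cos \<theta>)"
    by simp_all
qed

text \<open>The thresholds are \<open>cos (pi / 3) = 1 / 2\<close>, giving
  \<open>\<rho> = 3\<close>, and \<open>cos (2 * pi / 3) = - 1 / 2\<close>, giving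
  \<open>\<rho> = 1\<close>; in between, \<open>\<rho>\<close> decreases with the angle.\<close>

lemma parameter_of_angle:
  assumes "0 < \<theta>" "\<theta> \<le> pi"
  shows "3 / (2 - 2 * cos \<theta>) < 3 \<longleftrightarrow> pi / 3 < \<theta>" "3 / (2 - 2 * cos \<theta>) > 3 \<longleftrightarrow> \<theta> < pi / 3"
    and "3 / (2 - 2 * cos \<theta>) < 1 \<longleftrightarrow> 2 * pi / 3 < \<theta>" "3 / (2 - 2 * cos \<theta>) > 1 \<longleftrightarrow> \<theta> < 2 * pi / 3"
proof -
  have c1: "cos \<theta> < 1"
    using cos_monotone_0_pi[of 0 \<theta>] assms by simp
  have mono: "cos \<theta> < cos \<phi> \<longleftrightarrow> \<phi> < \<theta>" "cos \<phi> < cos \<theta> \<longleftrightarrow> \<theta> < \<phi>" if "0 \<le> \<phi>" "\<phi> \<le> pi" for \<phi>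
    by (rule cos_mono_less_eq; use assms that in linarith)+
  have range: "0 \<le> pi / 3" "pi / 3 \<le> pi" "0 \<le> 2 * pi / 3" "2 * pi / 3 \<le> pi"
    using pi_gt_zero by linarith+
  have "3 / (2 - 2 * cos \<theta>) < 3 \<longleftrightarrow> cos \<theta> < 1 / 2" "3 / (2 - 2 * cos \<theta>) > 3 \<longleftrightarrow> cos \<theta> > 1 / 2"
    "3 / (2 - 2 * cos \<theta>) < 1 \<longleftrightarrow> cos \<theta> < - 1 / 2" "3 / (2 - 2 * cos \<theta>) > 1 \<longleftrightarrow> cos \<theta> > - 1 / 2"
    using c1 by (auto simp: field_simps)
  then show "3 / (2 - 2 * cos \<theta>) < 3 \<longleftrightarrow> pi / 3 < \<theta>" "3 / (2 - 2 * cos \<theta>) > 3 \<longleftrightarrow> \<theta> < pi / 3"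
    "3 / (2 - 2 * cos \<theta>) < 1 \<longleftrightarrow> 2 * pi / 3 < \<theta>" "3 / (2 - 2 * cos \<theta>) > 1 \<longleftrightarrow> \<theta> < 2 * pi / 3"
    using mono[OF range(1,2), unfolded cos_60] mono[OF range(3,4), unfolded cos_120] by (simp_all only:)
qed

lemma config_space_model:
  assumes "0 < \<theta>" "\<theta> \<le> pi"
  defines "\<rho> \<equiv> 3 / (2 - 2 * cos \<theta>)"
  obtains f where "homeomorphic_map (config_space \<theta>) (top_of_set (model \<rho>)) f"
    "\<And>P. P \<in> hexagons \<theta> \<Longrightarrow> fst (f (config_class P)) = 0 \<longleftrightarrow> equal_diagonals P"
proof -
  obtain r where r: "0 < r" "3 * r\<^sup>2 = 2 - 2 * cos \<theta>" "1 / r\<^sup>2 = \<rho>"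
    using radius_of_angle[OF assms(1,2)] unfolding \<rho>_def by blast
  have \<theta>: "0 \<le> \<theta>" "\<theta> \<le> pi"
    using assms by auto
  note h = homeomorphic_map_class_coords[OF \<theta> r(1,2), unfolded r(3)]
  have "fst (class_coords \<theta> r (config_class P)) = 0 \<longleftrightarrow> equal_diagonals P" if "P \<in> hexagons \<theta>" for P
    using that r(1) by (simp add: class_coords_config_class equal_diagonals_iff_coords[OF \<theta> r(1,2)])
  with h show ?thesis
    using that by blast
qed

text \<open>The set \<open>M\<close> is left general so that the same transport serves the models
  below and above 3.\<close>

lemma boat_chair_of_homeomorphism:
  assumes \<theta>: "0 < \<theta>" "\<theta> < 2 * pi / 3" and f: "homeomorphic_map (config_space \<theta>) (top_of_set M) f"
    "\<And>P. P \<in> hexagons \<theta> \<Longrightarrow> fst (f (config_class P)) = 0 \<longleftrightarrow> equal_diagonals P"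
    and circ: "\<And>x. x \<in> M \<Longrightarrow> fst x \<noteq> 0 \<Longrightarrow> in_circle_component (top_of_set M) x"
    and pt: "\<And>x. x \<in> M \<Longrightarrow> fst x = 0 \<Longrightarrow> openin (top_of_set M) {x}"
    and P: "P \<in> hexagons \<theta>"
  shows "boat P \<Longrightarrow> in_circle_component (config_space \<theta>) (config_class P)"
    and "chair P \<Longrightarrow> openin (config_space \<theta>) {config_class P}"
proof -
  have pi: "\<theta> \<le> pi"
    using \<theta> by simp
  have mem: "config_class P \<in> topspace (config_space \<theta>)"
    using P by (auto simp: topspace_config_space)
  have fM: "f (config_class P) \<in> M"
    using homeomorphic_imp_surjective_map[OF f(1)] mem by auto
  show "in_circle_component (config_space \<theta>) (config_class P)" if "boat P"
    using in_circle_component_homeomorphic[OF f(1) mem] circ[OF fM] f(2)[OF P]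
      boat_not_equal_diagonals[OF P \<theta>(1) pi that] by blast
  show "openin (config_space \<theta>) {config_class P}" if "chair P"
    using homeomorphic_map_openness[OF f(1), of "{config_class P}"] mem pt[OF fM] f(2)[OF P]
      chair_equal_diagonals[OF P \<theta>(1) pi that] by simp
qed

theorem corollary3p2:
  fixes \<theta> :: real
  assumes "\<theta> \<noteq> pi / 3"
  shows "(\<theta> = 0 \<or> \<theta> = 2 * pi / 3 \<longrightarrow> config_space \<theta> homeomorphic_space point_space) \<and>
    (pi / 3 < \<theta> \<and> \<theta> < 2 * pi / 3 \<longrightarrow>
      config_space \<theta> homeomorphic_space circles_and_points 1 2) \<and>
    (0 < \<theta> \<and> \<theta> < pi / 3 \<longrightarrow>
      config_space \<theta> homeomorphic_space circles_and_points 2 4) \<and>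
    (\<theta> < 0 \<or> \<theta> > 2 * pi / 3 \<longrightarrow>
      config_space \<theta> homeomorphic_space (trivial_topology :: complex topology)) \<and>
    (0 < \<theta> \<and> \<theta> < 2 * pi / 3 \<longrightarrow>
      (\<forall>P \<in> hexagons \<theta>. boat P \<longrightarrow>
        (\<exists>C \<in> connected_components_of (config_space \<theta>).
          config_class P \<in> C \<and> subtopology (config_space \<theta>) C homeomorphic_space circle_space)) \<and>
      (\<forall>P \<in> hexagons \<theta>. chair P \<longrightarrow> openin (config_space \<theta>) {config_class P}))"
proof -
  define \<rho> where "\<rho> = 3 / (2 - 2 * cos \<theta>)"
  have hom: "config_space \<theta> homeomorphic_space top_of_set (model \<rho>)" if \<theta>: "0 < \<theta>" "\<theta> \<le> pi"
  proof -
    obtain f where "homeomorphic_map (config_space \<theta>) (top_of_set (model \<rho>)) f"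
      using config_space_model[OF \<theta>] unfolding \<rho>_def by blast
    then show ?thesis
      by (rule homeomorphic_map_imp_homeomorphic_space)
  qed
  have mid: "1 < \<rho> \<and> \<rho> < 3" if "pi / 3 < \<theta>" "\<theta> < 2 * pi / 3"
  proof -
    have "0 < \<theta>"
      using that(1) pi_gt_zero by linarith
    then show ?thesis
      using parameter_of_angle[of \<theta>] that by (simp add: \<rho>_def)
  qed
  have low: "3 < \<rho>" if "0 < \<theta>" "\<theta> < pi / 3"
    using parameter_of_angle[of \<theta>] that by (simp add: \<rho>_def)
  have pt: "config_space \<theta> homeomorphic_space point_space" if "\<theta> = 0 \<or> \<theta> = 2 * pi / 3"
  proof (cases "\<theta> = 0")
    case True
    then show ?thesis
      using config_space_0 by simp
  next
    case False
    with that have eq: "\<theta> = 2 * pi / 3"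
      by simp
    then have \<theta>: "0 < \<theta>" "\<theta> \<le> pi"
      using pi_gt_zero by linarith+
    \<comment> \<open>\<open>\<rho>\<close> is neither below nor above 1 at this angle, so it equals
      1.\<close>
    with eq have "model \<rho> = {(0, 0, 0)}"
      using parameter_of_angle(3,4)[of \<theta>] model_1 by (simp add: \<rho>_def)
    then have "top_of_set (model \<rho>) homeomorphic_space point_space"
      using singleton_homeomorphic_point_space[of "(0, 0, 0)" euclidean] by simp
    then show ?thesis
      by (rule homeomorphic_space_trans[OF hom[OF \<theta>]])
  qed
  have empty: "config_space \<theta> homeomorphic_space (trivial_topology :: complex topology)"
    if "\<theta> < 0 \<or> \<theta> > 2 * pi / 3"
  \<comment> \<open>Outside \<open>[0, pi]\<close> no vertex angle can have this value. Between
    \<open>2 * pi / 3\<close> and \<open>pi\<close> the obstruction is \<open>\<rho> < 1\<close>,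
    for which the model has no solution.\<close>
  proof (cases "\<theta> < 0 \<or> \<theta> > pi")
    case True
    then show ?thesis
      by (simp add: config_space_empty hexagons_empty homeomorphic_empty_space_eq)
  next
    case False
    with that have \<theta>: "0 < \<theta>" "\<theta> \<le> pi" "\<theta> > 2 * pi / 3"
      using pi_gt_zero by linarith+
    then have "model \<rho> = {}"
      using parameter_of_angle(3)[of \<theta>] model_empty by (simp add: \<rho>_def)
    then have "config_space \<theta> = trivial_topology"
      using homeomorphic_empty_space[OF hom[OF \<theta>(1,2)]] by simp
    then show ?thesis
      by (simp add: homeomorphic_empty_space_eq)
  qed
  have types: "boat P \<longrightarrow> in_circle_component (config_space \<theta>) (config_class P)"
      "chair P \<longrightarrow> openin (config_space \<theta>) {config_class P}"
    if \<theta>: "0 < \<theta>" "\<theta> < 2 * pi / 3" and P: "P \<in> hexagons \<theta>" for P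
  proof -
    have "\<theta> \<le> pi"
      using \<theta> by simp
    then obtain f where f: "homeomorphic_map (config_space \<theta>) (top_of_set (model \<rho>)) f"
      "\<And>P. P \<in> hexagons \<theta> \<Longrightarrow> fst (f (config_class P)) = 0 \<longleftrightarrow> equal_diagonals P"
      using config_space_model[OF \<theta>(1)] unfolding \<rho>_def by blast
    \<comment> \<open>The excluded angle \<open>pi / 3\<close> is the one with
      \<open>\<rho> = 3\<close>.\<close>
    consider "1 < \<rho>" "\<rho> < 3" | "3 < \<rho>"
      using mid[OF _ \<theta>(2)] low[OF \<theta>(1)] assms by linarith
    then have "(boat P \<longrightarrow> in_circle_component (config_space \<theta>) (config_class P)) \<and>
        (chair P \<longrightarrow> openin (config_space \<theta>) {config_class P})"
    proof cases
      case 1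
      show ?thesis
        using boat_chair_of_homeomorphism[OF \<theta> f model_topology_below_3(2,3)[OF 1] P] by (intro conjI impI)
    next
      case 2
      show ?thesis
        using boat_chair_of_homeomorphism[OF \<theta> f model_topology_above_3(2,3)[OF 2] P] by (intro conjI impI)
    qed
    then show "boat P \<longrightarrow> in_circle_component (config_space \<theta>) (config_class P)"
      "chair P \<longrightarrow> openin (config_space \<theta>) {config_class P}"
      by auto
  qed
  have one: "config_space \<theta> homeomorphic_space circles_and_points 1 2" if "pi / 3 < \<theta>" "\<theta> < 2 * pi / 3"
  proof -
    have \<theta>: "0 < \<theta>" "\<theta> \<le> pi"
      using that pi_gt_zero by linarith+
    have "1 < \<rho>" "\<rho> < 3"
      using mid[OF that] by auto
    from homeomorphic_space_trans[OF hom[OF \<theta>] model_topology_below_3(1)[OF this]] show ?thesis .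
  qed
  have two: "config_space \<theta> homeomorphic_space circles_and_points 2 4" if "0 < \<theta>" "\<theta> < pi / 3"
  proof -
    have "\<theta> \<le> pi"
      using that by linarith
    from homeomorphic_space_trans[OF hom[OF that(1) this] model_topology_above_3(1)[OF low[OF that]]]
    show ?thesis .
  qed
  show ?thesis
    by (intro conjI impI ballI; (elim conjE)?)
      (simp_all only: pt one two empty types in_circle_component_def[symmetric])
qed


end
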